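(* Let $\beta>1$ be a non-integer and $p\in(0,1)$. Then there exists a unique $K_\beta$-invariant probability measure on $\Omega\times J_\beta$ that is absolutely continuous with respect to $m_p\otimes\lambda$. This measure is of the form $m_p\otimes\mu_{\beta,p}$, where $\mu_{\beta,p}$ is a probability measure on $J_\beta$ that is equivalent with $\lambda$ (i.e. mutually absolutely continuous); $K_\beta$ is ergodic with respect to $m_p\otimes\mu_{\beta,p}$, and $$\mu_{\beta,p}=p\cdot\mu_{\beta,p}\circ T_\beta^{-1}+(1-p)\cdot\mu_{\beta,p}\circ L_\beta^{-1}.$$
   Context: Let $J_\beta=[0,\lfloor\beta\rfloor/(\beta-1)]$ with Borel $\sigma$-algebra $\mathcal B$, and let $\lambda$ be the normalized Lebesgue measure on $J_\beta$. The greedy map $T_\beta:J_\beta\to J_\beta$ is $T_\beta(x)=\beta x-d$ for $x\in C(d)$, where $C(j)=[j/\beta,(j+1)/\beta)$ for $0\le j\le\lfloor\beta\rfloor-1$ and $C(\lfloor\beta\rfloor)=[\lfloor\beta\rfloor/\beta,\lfloor\beta\rfloor/(\beta-1)]$. With $\ell(x)=\lfloor\beta\rfloor/(\beta-1)-x$, the lazy map $L_\beta:J_\beta\to J_\beta$ is $L_\beta(x)=\beta x-d$ for $x\in\Delta(d)=\ell(C(\lfloor\beta\rfloor-d))$, $d\in\{0,\ldots,\lfloor\beta\rfloor\}$. Switch regions: $S_k=\left[\frac{k}{\beta},\frac{\lfloor\beta\rfloor}{\beta(\beta-1)}+\frac{k-1}{\beta}\right]$, $k=1,\ldots,\lfloor\beta\rfloor$.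 Equality regions: $E_0=[0,\frac1\beta)$, $E_k=\left(\frac{\lfloor\beta\rfloor}{\beta(\beta-1)}+\frac{k-1}{\beta},\frac{k+1}{\beta}\right)$ for $1\le k\le\lfloor\beta\rfloor-1$, and $E_{\lfloor\beta\rfloor}=\left(\frac{\lfloor\beta\rfloor}{\beta(\beta-1)}+\frac{\lfloor\beta\rfloor-1}{\beta},\frac{\lfloor\beta\rfloor}{\beta-1}\right]$. Let $\Omega=\{0,1\}^{\mathbb N}$ with product $\sigma$-algebra $\mathcal A$ and left shift $\sigma$. The map $K_\beta:\Omega\times J_\beta\to\Omega\times J_\beta$ is defined by $K_\beta(\omega,x)=(\omega,\beta x-k)$ if $x\in E_k$; $K_\beta(\omega,x)=(\sigma(\omega),\beta x-k)$ if $x\in S_k$ and $\omega_1=1$; $K_\beta(\omega,x)=(\sigma(\omega),\beta x-k+1)$ if $x\in S_k$ and $\omega_1=0$. $m_p$ is the Bernoulli measure on $\Omega$: $m_p(\{\omega_1=i_1,\ldots,\omega_n=i_n\})=p^{\sum_j i_j}(1-p)^{n-\sum_j i_j}$. The product space carries $\mathcal A\otimes\mathcal B$. *)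

theory Defs
  imports "HOL-Probability.Probability"
begin

section \<open>The interval and its digit partitions\<close>

definition expansion_interval :: "real \<Rightarrow> real set" where
  "expansion_interval \<beta> = {0 .. of_int \<lfloor>\<beta>\<rfloor> / (\<beta> - 1)}"

definition normalized_lebesgue :: "real \<Rightarrow> real measure" where
  "normalized_lebesgue \<beta> = uniform_measure (restrict_space lborel (expansion_interval \<beta>)) (expansion_interval \<beta>)"

definition reflection :: "real \<Rightarrow> real \<Rightarrow> real" where
  "reflection \<beta> x = of_int \<lfloor>\<beta>\<rfloor> / (\<beta> - 1) - x"

definition greedy_cell :: "real \<Rightarrow> int \<Rightarrow> real set" where
  "greedy_cell \<beta> d =
     (if d = \<lfloor>\<beta>\<rfloor> then {of_int d / \<beta> .. of_int \<lfloor>\<beta>\<rfloor> / (\<beta> - 1)}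
      else {of_int d / \<beta> ..< (of_int d + 1) / \<beta>})"

definition lazy_cell :: "real \<Rightarrow> int \<Rightarrow> real set" where
  "lazy_cell \<beta> d = reflection \<beta> ` greedy_cell \<beta> (\<lfloor>\<beta>\<rfloor> - d)"

definition switch_region :: "real \<Rightarrow> int \<Rightarrow> real set" where
  "switch_region \<beta> k =
     {of_int k / \<beta> .. of_int \<lfloor>\<beta>\<rfloor> / (\<beta> * (\<beta> - 1)) + (of_int k - 1) / \<beta>}"

definition equality_region :: "real \<Rightarrow> int \<Rightarrow> real set" where
  "equality_region \<beta> k =
     (if k = 0 then {0 ..< 1 / \<beta>}
      else if k = \<lfloor>\<beta>\<rfloor> then
        {of_int \<lfloor>\<beta>\<rfloor> / (\<beta> * (\<beta> - 1)) + (of_int \<lfloor>\<beta>\<rfloor> - 1) / \<beta> <.. of_int \<lfloor>\<beta>\<rfloor> / (\<beta> - 1)}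
      else
        {of_int \<lfloor>\<beta>\<rfloor> / (\<beta> * (\<beta> - 1)) + (of_int k - 1) / \<beta> <..< (of_int k + 1) / \<beta>})"


section \<open>The greedy, lazy and random maps\<close>

text \<open>
  The digit is selected with a definite description. The lemmas in the last section show that for
  non-integer \<open>\<beta> > 1\<close> it is well defined on all of \<open>expansion_interval \<beta>\<close>; values outside
  \<open>expansion_interval \<beta>\<close> are junk.
\<close>

definition greedy_map :: "real \<Rightarrow> real \<Rightarrow> real" where
  "greedy_map \<beta> x = \<beta> * x - of_int (THE d. d \<in> {0..\<lfloor>\<beta>\<rfloor>} \<and> x \<in> greedy_cell \<beta> d)"

definition lazy_map :: "real \<Rightarrow> real \<Rightarrow> real" where
  "lazy_map \<beta> x = \<beta> * x - of_int (THE d. d \<in> {0..\<lfloor>\<beta>\<rfloor>} \<and> x \<in> lazy_cell \<beta> d)"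

text \<open>
  \<open>\<Omega>\<close> is the type \<^typ>\<open>nat \<Rightarrow> bool\<close>, with \<^const>\<open>True\<close> for the symbol 1 and
  indices starting at 0, so that \<open>\<omega> 0\<close> is the first coordinate.
\<close>

definition shift :: "(nat \<Rightarrow> bool) \<Rightarrow> nat \<Rightarrow> bool" where
  "shift \<omega> = (\<lambda>n. \<omega> (Suc n))"

definition random_map :: "real \<Rightarrow> (nat \<Rightarrow> bool) \<times> real \<Rightarrow> (nat \<Rightarrow> bool) \<times> real" where
  "random_map \<beta> = (\<lambda>(\<omega>, x).
     if \<exists>k\<in>{0..\<lfloor>\<beta>\<rfloor>}. x \<in> equality_region \<beta> k
     then (\<omega>, \<beta> * x - of_int (THE k. k \<in> {0..\<lfloor>\<beta>\<rfloor>} \<and> x \<in> equality_region \<beta> k))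
     else let k = (THE k. k \<in> {1..\<lfloor>\<beta>\<rfloor>} \<and> x \<in> switch_region \<beta> k)
          in (shift \<omega>, if \<omega> 0 then \<beta> * x - of_int k else \<beta> * x - of_int k + 1))"

definition bernoulli_measure :: "real \<Rightarrow> (nat \<Rightarrow> bool) measure" where
  "bernoulli_measure p = PiM UNIV (\<lambda>_. measure_pmf (bernoulli_pmf p))"


section \<open>Invariance and ergodicity\<close>

definition invariant_measure :: "('a \<Rightarrow> 'a) \<Rightarrow> 'a measure \<Rightarrow> bool" where
  "invariant_measure f M \<longleftrightarrow> f \<in> measurable M M \<and> distr M M f = M"

definition ergodic :: "('a \<Rightarrow> 'a) \<Rightarrow> 'a measure \<Rightarrow> bool" where
  "ergodic f M \<longleftrightarrow> prob_space M \<and> invariant_measure f M \<and>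
     (\<forall>A\<in>sets M. f -` A \<inter> space M = A \<longrightarrow> measure M A = 0 \<or> measure M A = 1)"

definition acim :: "real \<Rightarrow> real \<Rightarrow> ((nat \<Rightarrow> bool) \<times> real) measure \<Rightarrow> bool" where
  "acim \<beta> p \<nu> \<longleftrightarrow> prob_space \<nu> \<and>
     sets \<nu> = sets (bernoulli_measure p \<Otimes>\<^sub>M normalized_lebesgue \<beta>) \<and>
     absolutely_continuous (bernoulli_measure p \<Otimes>\<^sub>M normalized_lebesgue \<beta>) \<nu> \<and>
     invariant_measure (random_map \<beta>) \<nu>"


section \<open>Consistency of the definitions\<close>

lemma space_normalized_lebesgue [simp]: "space (normalized_lebesgue \<beta>) = expansion_interval \<beta>"
  by (simp add: normalized_lebesgue_def space_restrict_space)

lemma sets_normalized_lebesgue: "sets (normalized_lebesgue \<beta>) = sets (restrict_space borel (expansion_interval \<beta>))"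
  by (simp add: normalized_lebesgue_def sets_restrict_space)

lemma prob_space_normalized_lebesgue:
  assumes "\<beta> > 1"
  shows "prob_space (normalized_lebesgue \<beta>)"
proof -
  have "\<lfloor>\<beta>\<rfloor> \<ge> 1" using assms by linarith
  hence *: "of_int \<lfloor>\<beta>\<rfloor> / (\<beta> - 1) > 0" using assms by simp
  have "emeasure (restrict_space lborel (expansion_interval \<beta>)) (expansion_interval \<beta>) = ennreal (of_int \<lfloor>\<beta>\<rfloor> / (\<beta> - 1))"
    using * by (simp add: emeasure_restrict_space expansion_interval_def)
  thus ?thesis unfolding normalized_lebesgue_def using * by (intro prob_space_uniform_measure) auto
qed

context
  fixes \<beta> :: real
  assumes beta: "\<beta> > 1" "\<beta> \<notin> \<int>"
begin

lemma floor_bounds: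
  "\<lfloor>\<beta>\<rfloor> \<ge> 1" "of_int \<lfloor>\<beta>\<rfloor> < \<beta>" "\<beta> < of_int \<lfloor>\<beta>\<rfloor> + 1"
proof -
  show "\<lfloor>\<beta>\<rfloor> \<ge> 1" "\<beta> < of_int \<lfloor>\<beta>\<rfloor> + 1" using beta by linarith+
  have "of_int \<lfloor>\<beta>\<rfloor> \<noteq> \<beta>" using beta(2) by (metis Ints_of_int)
  thus "of_int \<lfloor>\<beta>\<rfloor> < \<beta>" using of_int_floor_le[of \<beta>] by linarith
qed

private abbreviation "a \<equiv> of_int \<lfloor>\<beta>\<rfloor> / (\<beta> - 1)"

lemma right_end_bounds: "a > 1" "\<lfloor>\<beta>\<rfloor> \<ge> 2 \<Longrightarrow> a < 2"
proof -
  show "a > 1" using floor_bounds beta by (simp add: field_simps)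
  assume "\<lfloor>\<beta>\<rfloor> \<ge> 2"
  hence "of_int \<lfloor>\<beta>\<rfloor> \<ge> (2::real)" by linarith
  thus "a < 2" using floor_bounds beta by (simp add: field_simps)
qed

lemma right_end_mult: "\<beta> * a = a + of_int \<lfloor>\<beta>\<rfloor>"
  using beta by (simp add: field_simps)

lemma right_end_div: "of_int \<lfloor>\<beta>\<rfloor> / (\<beta> * (\<beta> - 1)) = a / \<beta>"
  by simp

lemma scale_iff:
  "x \<le> y / \<beta> \<longleftrightarrow> \<beta> * x \<le> y" "x < y / \<beta> \<longleftrightarrow> \<beta> * x < y"
  "y / \<beta> \<le> x \<longleftrightarrow> y \<le> \<beta> * x" "y / \<beta> < x \<longleftrightarrow> y < \<beta> * x"
  using beta by (auto simp: field_simps)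

lemma le_right_end_iff: "x \<le> a \<longleftrightarrow> \<beta> * x \<le> a + of_int \<lfloor>\<beta>\<rfloor>"
  unfolding right_end_mult[symmetric] using beta mult_le_cancel_left_pos[of \<beta> x a] by linarith

lemma mem_interval_iff:
  "x \<in> expansion_interval \<beta> \<longleftrightarrow> 0 \<le> \<beta> * x \<and> \<beta> * x \<le> a + of_int \<lfloor>\<beta>\<rfloor>"
  unfolding expansion_interval_def atLeastAtMost_iff le_right_end_iff
  using beta by (simp add: zero_le_mult_iff)

lemma mem_greedy_cell_iff:
  "x \<in> greedy_cell \<beta> d \<longleftrightarrow> of_int d \<le> \<beta> * x \<and>
     (if d = \<lfloor>\<beta>\<rfloor> then \<beta> * x \<le> a + of_int \<lfloor>\<beta>\<rfloor> else \<beta> * x < of_int d + 1)"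
  by (simp add: greedy_cell_def scale_iff le_right_end_iff)

lemma mem_switch_region_iff:
  "x \<in> switch_region \<beta> k \<longleftrightarrow> of_int k \<le> \<beta> * x \<and> \<beta> * x \<le> a + of_int k - 1"
proof -
  have "of_int \<lfloor>\<beta>\<rfloor> / (\<beta> * (\<beta> - 1)) + (of_int k - 1) / \<beta> = (a + of_int k - 1) / \<beta>"
    unfolding right_end_div by (simp add: add_divide_distrib diff_divide_distrib)
  thus ?thesis by (simp only: switch_region_def scale_iff atLeastAtMost_iff)
qed

lemma mem_equality_region_iff:
  "x \<in> equality_region \<beta> k \<longleftrightarrow>
     (if k = 0 then 0 \<le> \<beta> * x else a + of_int k - 1 < \<beta> * x) \<and>
     (if k = \<lfloor>\<beta>\<rfloor> then \<beta> * x \<le> a + of_int \<lfloor>\<beta>\<rfloor> else \<beta> * x < of_int k + 1)"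
proof -
  have *: "of_int \<lfloor>\<beta>\<rfloor> / (\<beta> * (\<beta> - 1)) + (of_int j - 1) / \<beta> = (a + of_int j - 1) / \<beta>" for j
    unfolding right_end_div by (simp add: add_divide_distrib diff_divide_distrib)
  have "0 \<le> x \<longleftrightarrow> 0 \<le> \<beta> * x" using beta by (simp add: zero_le_mult_iff)
  note intervals = this scale_iff le_right_end_iff atLeastLessThan_iff greaterThanAtMost_iff
    greaterThanLessThan_iff
  have "0 \<noteq> \<lfloor>\<beta>\<rfloor>" using floor_bounds(1) by linarith
  hence nz: "(0 = \<lfloor>\<beta>\<rfloor>) = False" by blast
  show ?thesis
  proof (cases "k = 0")
    case True
    show ?thesis unfolding True equality_region_def nz intervals refl[THEN eqTrueI] if_True if_False
      by simp
  next
    case False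
    hence "(k = 0) = False" by simp
    show ?thesis unfolding equality_region_def * \<open>(k = 0) = False\<close> if_False
      by (cases "k = \<lfloor>\<beta>\<rfloor>") (simp_all only: intervals simp_thms if_True if_False)
  qed
qed

lemma greedy_cell_unique:
  assumes "d \<in> {0..\<lfloor>\<beta>\<rfloor>}" "d' \<in> {0..\<lfloor>\<beta>\<rfloor>}" "x \<in> greedy_cell \<beta> d" "x \<in> greedy_cell \<beta> d'"
  shows "d = d'"
  using assms unfolding mem_greedy_cell_iff by (auto split: if_splits)

lemma mem_lazy_cell_iff: "x \<in> lazy_cell \<beta> d \<longleftrightarrow> reflection \<beta> x \<in> greedy_cell \<beta> (\<lfloor>\<beta>\<rfloor> - d)"
proof -
  have "reflection \<beta> (reflection \<beta> y) = y" for y by (simp add: reflection_def)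
  thus ?thesis unfolding lazy_cell_def by (metis image_iff)
qed

lemma lazy_cell_unique:
  assumes "d \<in> {0..\<lfloor>\<beta>\<rfloor>}" "d' \<in> {0..\<lfloor>\<beta>\<rfloor>}" "x \<in> lazy_cell \<beta> d" "x \<in> lazy_cell \<beta> d'"
  shows "d = d'"
  using greedy_cell_unique[of "\<lfloor>\<beta>\<rfloor> - d" "\<lfloor>\<beta>\<rfloor> - d'" "reflection \<beta> x"] assms
  unfolding mem_lazy_cell_iff by auto

lemma greedy_cell_cover:
  assumes "x \<in> expansion_interval \<beta>"
  shows "\<exists>d\<in>{0..\<lfloor>\<beta>\<rfloor>}. x \<in> greedy_cell \<beta> d"
proof (cases "of_int \<lfloor>\<beta>\<rfloor> \<le> \<beta> * x")
  case True
  thus ?thesis using assms floor_bounds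
    by (intro bexI[of _ "\<lfloor>\<beta>\<rfloor>"]) (auto simp: mem_greedy_cell_iff mem_interval_iff)
next
  case False
  hence "\<lfloor>\<beta> * x\<rfloor> < \<lfloor>\<beta>\<rfloor>" by linarith
  moreover have "0 \<le> \<lfloor>\<beta> * x\<rfloor>" using assms by (simp add: mem_interval_iff)
  ultimately show ?thesis
    by (intro bexI[of _ "\<lfloor>\<beta> * x\<rfloor>"]) (auto simp: mem_greedy_cell_iff)
qed

lemma lazy_cell_cover:
  assumes "x \<in> expansion_interval \<beta>"
  shows "\<exists>d\<in>{0..\<lfloor>\<beta>\<rfloor>}. x \<in> lazy_cell \<beta> d"
proof -
  have "reflection \<beta> x \<in> expansion_interval \<beta>"
    using assms by (simp add: expansion_interval_def reflection_def)
  then obtain d where "d \<in> {0..\<lfloor>\<beta>\<rfloor>}" "reflection \<beta> x \<in> greedy_cell \<beta> d"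
    using greedy_cell_cover by blast
  thus ?thesis by (intro bexI[of _ "\<lfloor>\<beta>\<rfloor> - d"]) (auto simp: mem_lazy_cell_iff)
qed

lemma greedy_map_eq:
  assumes "d \<in> {0..\<lfloor>\<beta>\<rfloor>}" "x \<in> greedy_cell \<beta> d"
  shows "greedy_map \<beta> x = \<beta> * x - of_int d"
proof -
  have "(THE d. d \<in> {0..\<lfloor>\<beta>\<rfloor>} \<and> x \<in> greedy_cell \<beta> d) = d"
    using assms greedy_cell_unique by (intro the_equality) blast+
  thus ?thesis by (simp add: greedy_map_def)
qed

lemma lazy_map_eq:
  assumes "d \<in> {0..\<lfloor>\<beta>\<rfloor>}" "x \<in> lazy_cell \<beta> d"
  shows "lazy_map \<beta> x = \<beta> * x - of_int d"
proof -
  have "(THE d. d \<in> {0..\<lfloor>\<beta>\<rfloor>} \<and> x \<in> lazy_cell \<beta> d) = d"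
    using assms lazy_cell_unique by (intro the_equality) blast+
  thus ?thesis by (simp add: lazy_map_def)
qed

lemma equality_region_unique:
  assumes "k \<in> {0..\<lfloor>\<beta>\<rfloor>}" "j \<in> {0..\<lfloor>\<beta>\<rfloor>}" "x \<in> equality_region \<beta> k" "x \<in> equality_region \<beta> j"
  shows "k = j"
proof -
  have *: False if "k < j" "k \<in> {0..\<lfloor>\<beta>\<rfloor>}" "j \<in> {0..\<lfloor>\<beta>\<rfloor>}"
    "x \<in> equality_region \<beta> k" "x \<in> equality_region \<beta> j" for k j
  proof -
    have "of_int k + 1 \<le> (of_int j :: real)" using that(1) by linarith
    thus False using that right_end_bounds(1) unfolding mem_equality_region_iff
      by (auto split: if_splits)
  qed
  show ?thesis using *[of k j] *[of j k] assms by (metis linorder_neqE)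
qed

lemma switch_region_unique:
  assumes "k \<in> {1..\<lfloor>\<beta>\<rfloor>}" "j \<in> {1..\<lfloor>\<beta>\<rfloor>}" "x \<in> switch_region \<beta> k" "x \<in> switch_region \<beta> j"
  shows "k = j"
proof -
  have *: False if "k < j" "k \<in> {1..\<lfloor>\<beta>\<rfloor>}" "j \<in> {1..\<lfloor>\<beta>\<rfloor>}"
    "x \<in> switch_region \<beta> k" "x \<in> switch_region \<beta> j" for k j
  proof -
    have "of_int k + 1 \<le> (of_int j :: real)" using that(1) by linarith
    moreover have "\<lfloor>\<beta>\<rfloor> \<ge> 2" using that unfolding atLeastAtMost_iff by linarith
    note right_end_bounds(2)[OF this]
    ultimately show False using that unfolding mem_switch_region_iff by linarith
  qed
  show ?thesis using *[of k j] *[of j k] assms by (metis linorder_neqE)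
qed

lemma equality_switch_disjoint:
  assumes "k \<in> {0..\<lfloor>\<beta>\<rfloor>}" "j \<in> {1..\<lfloor>\<beta>\<rfloor>}"
  shows "equality_region \<beta> k \<inter> switch_region \<beta> j = {}"
proof (cases "j \<le> k")
  case True
  hence "of_int j \<le> (of_int k :: real)" by simp
  thus ?thesis using assms True by (auto simp: mem_equality_region_iff mem_switch_region_iff)
next
  case False
  hence "of_int k + 1 \<le> (of_int j :: real)" by linarith
  thus ?thesis using assms False by (auto simp: mem_equality_region_iff mem_switch_region_iff)
qed

lemma region_cover:
  assumes "x \<in> expansion_interval \<beta>"
  shows "(\<exists>k\<in>{0..\<lfloor>\<beta>\<rfloor>}. x \<in> equality_region \<beta> k) \<or> (\<exists>k\<in>{1..\<lfloor>\<beta>\<rfloor>}. x \<in> switch_region \<beta> k)"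
proof -
  obtain d where d: "d \<in> {0..\<lfloor>\<beta>\<rfloor>}" "x \<in> greedy_cell \<beta> d"
    using greedy_cell_cover[OF assms] by blast
  have "x \<in> equality_region \<beta> d \<or> d \<ge> 1 \<and> x \<in> switch_region \<beta> d"
  proof (cases "d = 0")
    case True
    moreover have "d \<noteq> \<lfloor>\<beta>\<rfloor>" using True floor_bounds(1) by linarith
    ultimately show ?thesis using d by (simp add: mem_equality_region_iff mem_greedy_cell_iff)
  next
    case False
    hence "d \<ge> 1" using d by simp
    thus ?thesis using d(2)
      unfolding mem_equality_region_iff mem_switch_region_iff mem_greedy_cell_iff
      by (metis False linorder_not_less)
  qed
  thus ?thesis using d by auto
qed

lemma random_map_equality:
  assumes "k \<in> {0..\<lfloor>\<beta>\<rfloor>}" "x \<in> equality_region \<beta> k"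
  shows "random_map \<beta> (\<omega>, x) = (\<omega>, \<beta> * x - of_int k)"
proof -
  have "(THE k. k \<in> {0..\<lfloor>\<beta>\<rfloor>} \<and> x \<in> equality_region \<beta> k) = k"
    using assms equality_region_unique by (intro the_equality) blast+
  moreover have "\<exists>k\<in>{0..\<lfloor>\<beta>\<rfloor>}. x \<in> equality_region \<beta> k" using assms by blast
  ultimately show ?thesis by (simp only: random_map_def prod.case if_True)
qed

lemma random_map_switch:
  assumes "k \<in> {1..\<lfloor>\<beta>\<rfloor>}" "x \<in> switch_region \<beta> k"
  shows "random_map \<beta> (\<omega>, x) =
    (shift \<omega>, if \<omega> 0 then \<beta> * x - of_int k else \<beta> * x - of_int k + 1)"
proof -
  have "(THE k. k \<in> {1..\<lfloor>\<beta>\<rfloor>} \<and> x \<in> switch_region \<beta> k) = k"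
    using assms switch_region_unique by (intro the_equality) blast+
  moreover have "\<not> (\<exists>k\<in>{0..\<lfloor>\<beta>\<rfloor>}. x \<in> equality_region \<beta> k)"
    using assms equality_switch_disjoint by blast
  ultimately show ?thesis by (simp only: random_map_def prod.case if_False Let_def)
qed

end

lemma measure_bernoulli_cylinder:
  assumes "p \<in> {0..1}"
  shows "measure (bernoulli_measure p) {\<omega>. \<forall>j<n. \<omega> j = i j}
           = p ^ card {j. j < n \<and> i j} * (1 - p) ^ (n - card {j. j < n \<and> i j})"
proof -
  interpret product_prob_space "\<lambda>_::nat. measure_pmf (bernoulli_pmf p)" UNIV
    by unfold_locales
  have "measure (bernoulli_measure p) {\<omega>. \<forall>j<n. \<omega> j = i j}
      = measure (PiM UNIV (\<lambda>_. measure_pmf (bernoulli_pmf p)))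
          (prod_emb UNIV (\<lambda>_. measure_pmf (bernoulli_pmf p)) {..<n} (\<Pi>\<^sub>E j\<in>{..<n}. {i j}))"
    unfolding bernoulli_measure_def
    by (rule arg_cong[where f = "measure _"]) (auto simp: prod_emb_def restrict_def PiE_iff)
  also have "\<dots> = (\<Prod>j<n. pmf (bernoulli_pmf p) (i j))"
    by (subst measure_PiM_emb) (auto simp: measure_pmf_single)
  also have "\<dots> = (\<Prod>j<n. if i j then p else 1 - p)"
    using assms by (intro prod.cong) auto
  also have "\<dots> = p ^ card {j. j < n \<and> i j} * (1 - p) ^ card {j. j < n \<and> \<not> i j}"
    by (simp add: prod.If_cases Int_def Collect_neg_eq[symmetric] lessThan_def)
  also have "card {j. j < n \<and> \<not> i j} = n - card {j. j < n \<and> i j}"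
  proof -
    have "{j. j < n \<and> \<not> i j} = {..<n} - {j. j < n \<and> i j}" by auto
    moreover have "card ({..<n} - {j. j < n \<and> i j}) = card {..<n} - card {j. j < n \<and> i j}"
      by (rule card_Diff_subset) auto
    ultimately show ?thesis by simp
  qed
  finally show ?thesis .
qed

end

theory Submission
  imports Defs
begin

text \<open>
  Write \<open>Q g = p (g \<circ> T) + (1 - p) (g \<circ> L)\<close>, let \<open>P\<close> be the adjoint of \<open>Q\<close> with respect to Lebesgue
  measure, and let \<open>a\<close> be the right end of \<open>J\<close>.

  Existence. \<open>P\<close> maps the indicator of \<open>[0, t)\<close> to \<open>1/\<beta>\<close> times the mean of the indicators of \<open>[0, T t)\<close>
  and \<open>[0, L t)\<close>, plus nonnegative multiples of the indicators \<open>u\<close> of \<open>[0, 1)\<close> and \<open>v\<close> of \<open>(a - 1, a]\<close>.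
  Discounted sums along the random orbits of \<open>1\<close> and \<open>a - 1\<close> therefore span, up to multiples of \<open>u\<close> and
  \<open>v\<close>, a \<open>P\<close>-invariant plane, and a stationary vector of a stochastic \<open>2 \<times> 2\<close> matrix gives an explicit
  bounded invariant density. Both end branches are full, so this density is bounded away from \<open>0\<close>.

  Ergodicity on \<open>J\<close>. If \<open>g \<le> Q g\<close>, then stationarity and the variance identity give
  \<open>g = g \<circ> T = g \<circ> L\<close> almost everywhere, that is, \<open>g\<close> is invariant under all maps
  \<open>y \<mapsto> (y + d) / \<beta>\<close> of \<open>J\<close> into itself. The primitive of \<open>g\<close> minus its mean then satisfies a
  contracting functional equation and vanishes.

  Ergodicity on the product. For a \<open>K\<close>-invariant set \<open>A\<close> the measure of the fibre over \<open>x\<close> is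
  \<open>Q\<close>-harmonic, hence a constant \<open>c\<close>. By induction on the length, each fibre meets each cylinder \<open>B\<close> in
  measure \<open>c m(B)\<close>: the deviation is subharmonic and vanishes on the switch regions. So a fibre is
  independent of itself and \<open>c\<^sup>2 = c\<close>.
\<close>

section \<open>Branches of the greedy and the lazy map\<close>

locale random_beta_system =
  fixes \<beta> p :: real
  assumes beta: "\<beta> > 1" "\<beta> \<notin> \<int>" and p: "0 < p" "p < 1"
begin

definition top_digit :: int where "top_digit = \<lfloor>\<beta>\<rfloor>"

definition right_end :: real where "right_end = of_int top_digit / (\<beta> - 1)"

definition branch :: "int \<Rightarrow> real \<Rightarrow> real" where "branch d y = (y + of_int d) / \<beta>"

definition switching :: "real set" where
  "switching = {x \<in> expansion_interval \<beta>. \<exists>k\<in>{1..top_digit}. x \<in> switch_region \<beta> k}"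

abbreviation J :: "real set" where "J \<equiv> expansion_interval \<beta>"

abbreviation T :: "real \<Rightarrow> real" where "T \<equiv> greedy_map \<beta>"

abbreviation L :: "real \<Rightarrow> real" where "L \<equiv> lazy_map \<beta>"

abbreviation K :: "(nat \<Rightarrow> bool) \<times> real \<Rightarrow> (nat \<Rightarrow> bool) \<times> real" where "K \<equiv> random_map \<beta>"

lemmas folds = top_digit_def[symmetric] right_end_def[symmetric]
lemmas right_end_gt_1 = right_end_bounds(1)[OF beta, unfolded folds]
lemmas right_end_lt_2 = right_end_bounds(2)[OF beta, unfolded folds]
lemmas beta_right_end = right_end_mult[OF beta, unfolded folds]
lemmas top_digit_ge_1 = floor_bounds(1)[OF beta, unfolded folds]
lemmas mem_J_beta_iff = mem_interval_iff[OF beta, unfolded folds]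
lemmas mem_greedy_cell = mem_greedy_cell_iff[OF beta, unfolded folds]
lemmas mem_switch_region = mem_switch_region_iff[OF beta, unfolded folds]
lemmas mem_equality_region = mem_equality_region_iff[OF beta, unfolded folds]
lemmas greedy_eq = greedy_map_eq[OF beta, unfolded folds]
lemmas lazy_eq = lazy_map_eq[OF beta, unfolded folds]

lemma mem_J_iff: "x \<in> J \<longleftrightarrow> 0 \<le> x \<and> x \<le> right_end"
  by (simp add: expansion_interval_def right_end_def top_digit_def)

lemma beta_branch: "\<beta> * branch d y = y + of_int d"
  using beta by (simp add: branch_def)

lemma branch_beta: "branch d (\<beta> * x - of_int d) = x"
  using beta by (simp add: branch_def)

lemma branch_mem_J:
  assumes "y \<in> J" "d \<in> {0..top_digit}"
  shows "branch d y \<in> J"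
proof -
  have "of_int d \<le> (of_int top_digit :: real)" "(0::real) \<le> of_int d"
    using assms by auto
  thus ?thesis
    using assms(1) unfolding mem_J_beta_iff[of "branch d y"] beta_branch mem_J_iff[of y] by linarith
qed

text \<open>The expanding map sends each greedy cell onto \<open>[0, 1)\<close>, except that the
  cell of the top digit covers all of \<open>J\<close>. This condition reappears as a weight in
  \<open>transfer\<close>.\<close>

lemma branch_mem_greedy_cell_iff:
  assumes "d \<in> {0..top_digit}"
  shows "branch d y \<in> greedy_cell \<beta> d \<longleftrightarrow> y \<in> J \<and> (d = top_digit \<or> y < 1)"
  using right_end_gt_1 unfolding mem_greedy_cell beta_branch mem_J_iff by auto

text \<open>In the scaled variable the reflection is
  \<open>\<beta> * x \<mapsto> right_end + top_digit - \<beta> * x\<close>, by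
  \<open>beta_right_end\<close>. It moves the open end of the cells to the left and makes digit
  \<open>0\<close> the exceptional one.\<close>

lemma mem_lazy_cell:
  "x \<in> lazy_cell \<beta> d \<longleftrightarrow> \<beta> * x - of_int d \<le> right_end \<and>
     (if d = 0 then 0 \<le> \<beta> * x else right_end - 1 < \<beta> * x - of_int d)"
proof -
  have "reflection \<beta> x = right_end - x"
    by (simp add: reflection_def right_end_def top_digit_def)
  hence "\<beta> * reflection \<beta> x = right_end + of_int top_digit - \<beta> * x"
    by (simp only: right_diff_distrib beta_right_end)
  thus ?thesis
    unfolding mem_lazy_cell_iff[OF beta] mem_greedy_cell top_digit_def[symmetric] by auto
qed

lemma branch_mem_lazy_cell_iff:
  assumes "d \<in> {0..top_digit}"
  shows "branch d y \<in> lazy_cell \<beta> d \<longleftrightarrow> y \<in> J \<and> (d = 0 \<or> right_end - 1 < y)"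
  using right_end_gt_1 unfolding mem_lazy_cell beta_branch mem_J_iff by auto

lemma greedy_map_branch:
  assumes "y \<in> J" "d \<in> {0..top_digit}" "d = top_digit \<or> y < 1"
  shows "T (branch d y) = y"
  using greedy_eq[OF assms(2)] branch_mem_greedy_cell_iff[OF assms(2)] assms
  by (simp add: beta_branch)

lemma lazy_map_branch:
  assumes "y \<in> J" "d \<in> {0..top_digit}" "d = 0 \<or> right_end - 1 < y"
  shows "L (branch d y) = y"
  using lazy_eq[OF assms(2)] branch_mem_lazy_cell_iff[OF assms(2)] assms
  by (simp add: beta_branch)

text \<open>For digits other than \<open>0\<close> and \<open>top_digit\<close> the images
  \<open>[0, 1)\<close> and \<open>(right_end - 1, right_end]\<close> of the two kinds of cells
  cover \<open>J\<close>, because \<open>right_end < 2\<close>. Thus invariance under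
  \<open>T\<close> and \<open>L\<close> yields invariance under all branches.\<close>

lemma greedy_or_lazy_map_branch:
  assumes "y \<in> J" "d \<in> {0..top_digit}"
  shows "T (branch d y) = y \<or> L (branch d y) = y"
proof (cases "d = 0 \<or> d = top_digit")
  case True
  thus ?thesis using assms greedy_map_branch lazy_map_branch by blast
next
  case False
  hence "top_digit \<ge> 2" using assms(2) by auto
  hence "y < 1 \<or> right_end - 1 < y" using right_end_lt_2 by linarith
  thus ?thesis using assms greedy_map_branch lazy_map_branch by blast
qed

lemma greedy_digitE:
  assumes "x \<in> J"
  obtains d where "d \<in> {0..top_digit}" "T x = \<beta> * x - of_int d" "T x \<in> J"
    "d = top_digit \<or> T x < 1" "x \<in> greedy_cell \<beta> d"
proof -
  obtain d where d: "d \<in> {0..top_digit}" "x \<in> greedy_cell \<beta> d"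
    using greedy_cell_cover[OF beta assms] by (auto simp: top_digit_def)
  have "T x = \<beta> * x - of_int d" by (rule greedy_eq[OF d])
  moreover have "branch d (\<beta> * x - of_int d) \<in> greedy_cell \<beta> d" using d by (simp add: branch_beta)
  ultimately show ?thesis using that d unfolding branch_mem_greedy_cell_iff[OF d(1)] by metis
qed

lemma lazy_digitE:
  assumes "x \<in> J"
  obtains d where "d \<in> {0..top_digit}" "L x = \<beta> * x - of_int d" "L x \<in> J"
    "d = 0 \<or> right_end - 1 < L x" "x \<in> lazy_cell \<beta> d"
proof -
  obtain d where d: "d \<in> {0..top_digit}" "x \<in> lazy_cell \<beta> d"
    using lazy_cell_cover[OF beta assms] by (auto simp: top_digit_def)
  have "L x = \<beta> * x - of_int d" by (rule lazy_eq[OF d])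
  moreover have "branch d (\<beta> * x - of_int d) \<in> lazy_cell \<beta> d" using d by (simp add: branch_beta)
  ultimately show ?thesis using that d unfolding branch_mem_lazy_cell_iff[OF d(1)] by metis
qed

lemma greedy_map_mem_J: "x \<in> J \<Longrightarrow> T x \<in> J"
  by (erule greedy_digitE)

lemma lazy_map_mem_J: "x \<in> J \<Longrightarrow> L x \<in> J"
  by (erule lazy_digitE)

text \<open>On the switch region of index \<open>k\<close> the greedy digit is \<open>k\<close> and
  the lazy digit is \<open>k - 1\<close>.\<close>

lemma random_map_switching:
  assumes "x \<in> switching"
  shows "K (\<omega>, x) = (shift \<omega>, if \<omega> 0 then T x else L x)"
proof -
  obtain k where k: "k \<in> {1..top_digit}" "x \<in> switch_region \<beta> k" and x: "x \<in> J"
    using assms by (auto simp: switching_def)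
  note K = random_map_switch[OF beta, unfolded folds, OF k]
  have b: "of_int k \<le> \<beta> * x" "\<beta> * x \<le> right_end + of_int k - 1"
    using k by (auto simp: mem_switch_region)
  \<comment> \<open>With one nonzero digit both cells in question are full branches. Otherwise
    \<open>right_end < 2\<close> keeps the switch region inside the shorter cells.\<close>
  have lt: "right_end < 2" if "k \<noteq> 1 \<or> k \<noteq> top_digit"
    using k(1) that by (intro right_end_lt_2) auto
  have "x \<in> greedy_cell \<beta> k"
    using b lt unfolding mem_greedy_cell by (cases "k = top_digit") auto
  hence "T x = \<beta> * x - of_int k" using k by (intro greedy_eq) auto
  moreover have "x \<in> lazy_cell \<beta> (k - 1)"
    using b lt unfolding mem_lazy_cell by (cases "k = 1") auto
  hence "L x = \<beta> * x - of_int (k - 1)" using k by (intro lazy_eq) auto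
  ultimately show ?thesis unfolding K by simp
qed

text \<open>An equality region lies in the greedy and in the lazy cell of the same digit.\<close>

lemma non_switching:
  assumes "x \<in> J" "x \<notin> switching"
  shows "K (\<omega>, x) = (\<omega>, T x)" and "L x = T x"
proof -
  obtain k where k: "k \<in> {0..top_digit}" "x \<in> equality_region \<beta> k"
    using region_cover[OF beta, unfolded folds, OF assms(1)] assms by (auto simp: switching_def)
  note b = k(2)[unfolded mem_equality_region]
  have "x \<in> greedy_cell \<beta> k"
    using b right_end_gt_1 unfolding mem_greedy_cell by (auto split: if_splits)
  hence T: "T x = \<beta> * x - of_int k" using k by (intro greedy_eq) auto
  have "x \<in> lazy_cell \<beta> k"
    using b right_end_gt_1 unfolding mem_lazy_cell by (auto split: if_splits)
  hence "L x = \<beta> * x - of_int k" using k by (intro lazy_eq) auto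
  thus "L x = T x" using T by simp
  show "K (\<omega>, x) = (\<omega>, T x)"
    unfolding T by (rule random_map_equality[OF beta, unfolded folds, OF k])
qed


section \<open>Measurability and branchwise change of variables\<close>

lemma J_borel [measurable]: "J \<in> sets borel"
  by (simp add: expansion_interval_def)

lemma greedy_cell_borel [measurable]: "greedy_cell \<beta> d \<in> sets borel"
  by (simp add: greedy_cell_def)

lemma lazy_cell_borel [measurable]: "lazy_cell \<beta> d \<in> sets borel"
proof -
  have "lazy_cell \<beta> d = {x. \<beta> * x - of_int d \<le> right_end \<and>
     (if d = 0 then 0 \<le> \<beta> * x else right_end - 1 < \<beta> * x - of_int d)}"
    using mem_lazy_cell by blast
  thus ?thesis by simp
qed

lemma branch_measurable [measurable]: "branch d \<in> borel_measurable borel"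
  unfolding branch_def by measurable

text \<open>Common treatment of \<open>T\<close> and \<open>L\<close>: here \<open>C d\<close> is the cell of the digit \<open>d\<close>, and \<open>I d\<close> cuts its
  image out of \<open>J\<close>.\<close>

lemma
  fixes S :: "real \<Rightarrow> real" and C :: "int \<Rightarrow> real set" and I :: "int \<Rightarrow> real \<Rightarrow> bool"
  assumes cell: "\<And>x. x \<in> J \<Longrightarrow> \<exists>d\<in>{0..top_digit}. x \<in> C d"
    and unique: "\<And>d d' x. d \<in> {0..top_digit} \<Longrightarrow> d' \<in> {0..top_digit} \<Longrightarrow> x \<in> C d \<Longrightarrow> x \<in> C d' \<Longrightarrow> d = d'"
    and S: "\<And>d x. d \<in> {0..top_digit} \<Longrightarrow> x \<in> C d \<Longrightarrow> S x = \<beta> * x - of_int d"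
    and I: "\<And>d y. d \<in> {0..top_digit} \<Longrightarrow> branch d y \<in> C d \<longleftrightarrow> y \<in> J \<and> I d y"
    and C [measurable]: "\<And>d. C d \<in> sets borel"
    and subset: "\<And>d. d \<in> {0..top_digit} \<Longrightarrow> C d \<subseteq> J"
  shows piecewise_map_measurable: "S \<in> borel_measurable (restrict_space borel J)"
    and piecewise_map_nn_integral:
      "\<And>F h. F \<in> borel_measurable borel \<Longrightarrow> h \<in> borel_measurable borel \<Longrightarrow>
        (\<integral>\<^sup>+x. (F (S x) * h x :: ennreal) * indicator J x \<partial>lborel) =
        (\<Sum>d\<in>{0..top_digit}. ennreal (1 / \<beta>) *
          (\<integral>\<^sup>+y. F y * h (branch d y) * of_bool (I d y) * indicator J y \<partial>lborel))"
proof -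
  \<comment> \<open>The identity is polymorphic in the value type: over the reals it gives
    measurability of \<open>S\<close>, over \<open>ennreal\<close> the integral formula.\<close>
  have split: "G (S x) x * indicator J x =
      (\<Sum>d\<in>{0..top_digit}. G (\<beta> * x - of_int d) x * indicator (C d) x)"
    for x and G :: "real \<Rightarrow> real \<Rightarrow> 'b :: {comm_semiring_1}"
  proof (cases "x \<in> J")
    case True
    then obtain d where d: "d \<in> {0..top_digit}" "x \<in> C d" using cell by blast
    have "(\<Sum>d\<in>{0..top_digit}. G (\<beta> * x - of_int d) x * indicator (C d) x)
        = (\<Sum>e\<in>{0..top_digit}. if e = d then G (\<beta> * x - of_int d) x else 0)"
      using d unique by (intro sum.cong) (auto simp: indicator_def)
    thus ?thesis using d S True by simp
  next
    case False
    hence "x \<notin> C d" if "d \<in> {0..top_digit}" for d using subset that by blast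
    thus ?thesis using False by simp
  qed
  have "S x = (\<Sum>d\<in>{0..top_digit}. (\<beta> * x - of_int d) * indicator (C d) x)" if "x \<in> J" for x
    using split[of "\<lambda>y x. y" x] that by simp
  moreover have "(\<lambda>x. \<Sum>d\<in>{0..top_digit}. (\<beta> * x - of_int d) * indicator (C d) x :: real)
      \<in> borel_measurable (restrict_space borel J)"
    by (intro measurable_restrict_space1) measurable
  ultimately show "S \<in> borel_measurable (restrict_space borel J)"
    by (subst measurable_cong) (auto simp: space_restrict_space)
  fix F h :: "real \<Rightarrow> ennreal"
  assume [measurable]: "F \<in> borel_measurable borel" "h \<in> borel_measurable borel"
  have "(\<integral>\<^sup>+x. F (\<beta> * x - of_int d) * h x * indicator (C d) x \<partial>lborel) =
      ennreal (1 / \<beta>) * (\<integral>\<^sup>+y. F y * h (branch d y) * of_bool (I d y) * indicator J y \<partial>lborel)"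
    if d: "d \<in> {0..top_digit}" for d
  proof -
    have br: "of_int d / \<beta> + 1 / \<beta> * y = branch d y" for y
      by (simp add: branch_def add_divide_distrib)
    have "F (\<beta> * branch d y - of_int d) * h (branch d y) * indicator (C d) (branch d y) =
        F y * h (branch d y) * of_bool (I d y) * indicator J y" for y
      using I[OF d, of y] by (auto simp: beta_branch indicator_def)
    thus ?thesis
      using beta by (subst nn_integral_real_affine[where c = "1 / \<beta>" and t = "of_int d / \<beta>"]) (simp_all only: br, auto)
  qed
  thus "(\<integral>\<^sup>+x. F (S x) * h x * indicator J x \<partial>lborel) =
        (\<Sum>d\<in>{0..top_digit}. ennreal (1 / \<beta>) *
          (\<integral>\<^sup>+y. F y * h (branch d y) * of_bool (I d y) * indicator J y \<partial>lborel))"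
    unfolding split[of "\<lambda>y x. F y * h x"] by (subst nn_integral_sum) (auto intro!: sum.cong)
qed

lemma greedy_cell_subset: "d \<in> {0..top_digit} \<Longrightarrow> greedy_cell \<beta> d \<subseteq> J"
  by (metis subsetI branch_beta branch_mem_greedy_cell_iff branch_mem_J)

lemma lazy_cell_subset: "d \<in> {0..top_digit} \<Longrightarrow> lazy_cell \<beta> d \<subseteq> J"
  by (metis subsetI branch_beta branch_mem_lazy_cell_iff branch_mem_J)

lemmas greedy_piecewise =
  greedy_cell_cover[OF beta, unfolded folds] greedy_cell_unique[OF beta, unfolded folds]
  greedy_eq branch_mem_greedy_cell_iff greedy_cell_borel greedy_cell_subset

lemmas lazy_piecewise =
  lazy_cell_cover[OF beta, unfolded folds] lazy_cell_unique[OF beta, unfolded folds]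
  lazy_eq branch_mem_lazy_cell_iff lazy_cell_borel lazy_cell_subset

lemma
  assumes "F \<in> borel_measurable borel" "h \<in> borel_measurable borel"
  shows greedy_map_nn_integral: "(\<integral>\<^sup>+x. (F (T x) * h x :: ennreal) * indicator J x \<partial>lborel) =
      (\<Sum>d\<in>{0..top_digit}. ennreal (1 / \<beta>) *
        (\<integral>\<^sup>+y. F y * h (branch d y) * of_bool (d = top_digit \<or> y < 1) * indicator J y \<partial>lborel))"
    and lazy_map_nn_integral: "(\<integral>\<^sup>+x. (F (L x) * h x :: ennreal) * indicator J x \<partial>lborel) =
      (\<Sum>d\<in>{0..top_digit}. ennreal (1 / \<beta>) *
        (\<integral>\<^sup>+y. F y * h (branch d y) * of_bool (d = 0 \<or> right_end - 1 < y) * indicator J y \<partial>lborel))"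
proof -
  show "(\<integral>\<^sup>+x. (F (T x) * h x :: ennreal) * indicator J x \<partial>lborel) =
      (\<Sum>d\<in>{0..top_digit}. ennreal (1 / \<beta>) *
        (\<integral>\<^sup>+y. F y * h (branch d y) * of_bool (d = top_digit \<or> y < 1) * indicator J y \<partial>lborel))"
    by (rule piecewise_map_nn_integral[OF greedy_piecewise]; (assumption | rule assms))
  show "(\<integral>\<^sup>+x. (F (L x) * h x :: ennreal) * indicator J x \<partial>lborel) =
      (\<Sum>d\<in>{0..top_digit}. ennreal (1 / \<beta>) *
        (\<integral>\<^sup>+y. F y * h (branch d y) * of_bool (d = 0 \<or> right_end - 1 < y) * indicator J y \<partial>lborel))"
    by (rule piecewise_map_nn_integral[OF lazy_piecewise]; (assumption | rule assms))
qed

lemma maps_measurable [measurable]: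
  "T \<in> measurable (restrict_space borel J) (restrict_space borel J)"
  "L \<in> measurable (restrict_space borel J) (restrict_space borel J)"
  using piecewise_map_measurable[OF greedy_piecewise] piecewise_map_measurable[OF lazy_piecewise]
  by (auto intro!: measurable_restrict_space2 simp: space_restrict_space greedy_map_mem_J lazy_map_mem_J)

section \<open>An explicit stationary density\<close>

text \<open>The two truth values decide whether \<open>branch d y\<close> lies in the greedy and in the lazy cell of \<open>d\<close>.\<close>

definition transfer :: "(real \<Rightarrow> real) \<Rightarrow> real \<Rightarrow> real" where
  "transfer h y = (\<Sum>d\<in>{0..top_digit}.
     (p * of_bool (d = top_digit \<or> y < 1) + (1 - p) * of_bool (d = 0 \<or> right_end - 1 < y)) *
     h (branch d y)) / \<beta>"

text \<open>The change of variables on the cells, summed with the weights \<open>p\<close> and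
  \<open>1 - p\<close>, shows that \<open>transfer\<close> is the adjoint \<open>P\<close> of
  \<open>Q\<close>.\<close>

lemma transfer_duality:
  fixes F :: "real \<Rightarrow> ennreal" and h :: "real \<Rightarrow> real"
  assumes [measurable]: "F \<in> borel_measurable borel" "h \<in> borel_measurable borel"
    and h: "\<And>x. h x \<ge> 0"
  shows "ennreal p * (\<integral>\<^sup>+x. F (T x) * ennreal (h x) * indicator J x \<partial>lborel) +
      ennreal (1 - p) * (\<integral>\<^sup>+x. F (L x) * ennreal (h x) * indicator J x \<partial>lborel) =
    (\<integral>\<^sup>+y. F y * ennreal (transfer h y) * indicator J y \<partial>lborel)"
proof -
  let ?g = "\<lambda>d y. of_bool (d = top_digit \<or> y < 1) :: ennreal"
  let ?l = "\<lambda>d y. of_bool (d = 0 \<or> right_end - 1 < y) :: ennreal"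
  have tr: "ennreal (transfer h y) = (\<Sum>d\<in>{0..top_digit}. ennreal (1 / \<beta>) *
      (ennreal p * ?g d y + ennreal (1 - p) * ?l d y) * ennreal (h (branch d y)))" for y
  proof -
    have "ennreal (transfer h y) = (\<Sum>d\<in>{0..top_digit}. ennreal (1 / \<beta> * (
      (p * of_bool (d = top_digit \<or> y < 1) + (1 - p) * of_bool (d = 0 \<or> right_end - 1 < y)) *
        h (branch d y))))"
      using beta p h unfolding transfer_def sum_divide_distrib
      by (subst sum_ennreal) auto
    also have "\<dots> = (\<Sum>d\<in>{0..top_digit}. ennreal (1 / \<beta>) *
      (ennreal p * ?g d y + ennreal (1 - p) * ?l d y) * ennreal (h (branch d y)))"
    proof (intro sum.cong refl)
      fix d
      have "ennreal (p * of_bool A + (1 - p) * of_bool B) = ennreal p * of_bool A + ennreal (1 - p) * of_bool B"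
        for A B using p by (cases A; cases B) (simp_all flip: ennreal_plus)
      moreover have "0 \<le> p * of_bool A + (1 - p) * of_bool B" for A B using p by simp
      ultimately show "ennreal (1 / \<beta> * (
      (p * of_bool (d = top_digit \<or> y < 1) + (1 - p) * of_bool (d = 0 \<or> right_end - 1 < y)) *
        h (branch d y))) = ennreal (1 / \<beta>) *
      (ennreal p * ?g d y + ennreal (1 - p) * ?l d y) * ennreal (h (branch d y))"
        using beta h by (simp only: mult.assoc[symmetric] ennreal_mult mult_nonneg_nonneg zero_le_divide_1_iff less_imp_le order.strict_trans[OF zero_less_one])
    qed
    finally show ?thesis .
  qed
  have [measurable]: "Measurable.pred borel (\<lambda>y::real. d = top_digit \<or> y < 1)"
    "Measurable.pred borel (\<lambda>y::real. d = 0 \<or> right_end - 1 < y)" for d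
    by measurable
  show ?thesis
    unfolding tr sum_distrib_left sum_distrib_right
      greedy_map_nn_integral[OF assms(1) measurable_compose[OF assms(2) measurable_ennreal]]
      lazy_map_nn_integral[OF assms(1) measurable_compose[OF assms(2) measurable_ennreal]]
  proof (subst nn_integral_sum)
    show "(\<Sum>d\<in>{0..top_digit}. ennreal p * (ennreal (1 / \<beta>) *
          (\<integral>\<^sup>+y. F y * ennreal (h (branch d y)) * ?g d y * indicator J y \<partial>lborel))) +
        (\<Sum>d\<in>{0..top_digit}. ennreal (1 - p) * (ennreal (1 / \<beta>) *
          (\<integral>\<^sup>+y. F y * ennreal (h (branch d y)) * ?l d y * indicator J y \<partial>lborel))) =
        (\<Sum>d\<in>{0..top_digit}. \<integral>\<^sup>+y. F y * (ennreal (1 / \<beta>) *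
          (ennreal p * ?g d y + ennreal (1 - p) * ?l d y) * ennreal (h (branch d y))) * indicator J y \<partial>lborel)"
      unfolding sum.distrib[symmetric]
    proof (intro sum.cong refl)
      fix d
      have "(\<integral>\<^sup>+y. F y * (ennreal (1 / \<beta>) *
          (ennreal p * ?g d y + ennreal (1 - p) * ?l d y) * ennreal (h (branch d y))) * indicator J y \<partial>lborel) =
        (\<integral>\<^sup>+y. ennreal p * (ennreal (1 / \<beta>) * (F y * ennreal (h (branch d y)) * ?g d y * indicator J y)) +
          ennreal (1 - p) * (ennreal (1 / \<beta>) * (F y * ennreal (h (branch d y)) * ?l d y * indicator J y)) \<partial>lborel)"
        by (intro nn_integral_cong) (simp only: distrib_left distrib_right mult_ac)
      also have "\<dots> = ennreal p * (ennreal (1 / \<beta>) *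
          (\<integral>\<^sup>+y. F y * ennreal (h (branch d y)) * ?g d y * indicator J y \<partial>lborel)) +
        ennreal (1 - p) * (ennreal (1 / \<beta>) *
          (\<integral>\<^sup>+y. F y * ennreal (h (branch d y)) * ?l d y * indicator J y \<partial>lborel))"
        by (simp add: nn_integral_add nn_integral_cmult)
      finally show "ennreal p * (ennreal (1 / \<beta>) *
          (\<integral>\<^sup>+y. F y * ennreal (h (branch d y)) * ?g d y * indicator J y \<partial>lborel)) +
        ennreal (1 - p) * (ennreal (1 / \<beta>) *
          (\<integral>\<^sup>+y. F y * ennreal (h (branch d y)) * ?l d y * indicator J y \<partial>lborel)) =
        (\<integral>\<^sup>+y. F y * (ennreal (1 / \<beta>) *
          (ennreal p * ?g d y + ennreal (1 - p) * ?l d y) * ennreal (h (branch d y))) * indicator J y \<partial>lborel)" ..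
    qed
  qed measurable
qed

end

section \<open>The action of \<open>transfer\<close> on indicators of initial intervals\<close>

lemma sum_digit_step:
  fixes c e :: real and D N :: int
  assumes "0 \<le> D" "D \<le> N"
  shows "(\<Sum>d\<in>{0..N}. if d < D then c else if d = D then e else 0) = of_int D * c + e"
proof -
  have "{0..N} = {0..<D} \<union> {D} \<union> {D<..N}" using assms by auto
  hence "(\<Sum>d\<in>{0..N}. if d < D then c else if d = D then e else 0) =
     (\<Sum>d\<in>{0..<D} \<union> {D} \<union> {D<..N}. if d < D then c else if d = D then e else 0)" by simp
  also have "\<dots> = (\<Sum>d\<in>{0..<D}. c) + e + (\<Sum>d\<in>{D<..N}. 0)"
    by (subst sum.union_disjoint; (subst sum.union_disjoint)?) auto
  finally show ?thesis using assms by simp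
qed

context random_beta_system begin

text \<open>This is \<open>Q ^ n\<close> applied to \<open>\<phi>\<close>, the expected value of
  \<open>\<phi>\<close> after \<open>n\<close> steps of the random orbit of \<open>t\<close>. The
  recursion changes the starting point, so inductions keep \<open>t\<close> arbitrary.\<close>

primrec iterate :: "(real \<Rightarrow> real) \<Rightarrow> nat \<Rightarrow> real \<Rightarrow> real" where
  "iterate \<phi> 0 t = \<phi> t"
| "iterate \<phi> (Suc n) t = p * iterate \<phi> n (T t) + (1 - p) * iterate \<phi> n (L t)"

lemma convex_bounds:
  fixes x y lo hi :: real
  assumes "lo \<le> x" "x \<le> hi" "lo \<le> y" "y \<le> hi"
  shows "lo \<le> p * x + (1 - p) * y" "p * x + (1 - p) * y \<le> hi"
proof -
  have "p * lo \<le> p * x" "p * x \<le> p * hi" "(1 - p) * lo \<le> (1 - p) * y" "(1 - p) * y \<le> (1 - p) * hi"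
    using assms p by (auto intro!: mult_left_mono)
  thus "lo \<le> p * x + (1 - p) * y" "p * x + (1 - p) * y \<le> hi" by (auto simp: algebra_simps)
qed

lemma iterate_bounds:
  assumes "\<And>t. t \<in> J \<Longrightarrow> lo \<le> \<phi> t \<and> \<phi> t \<le> hi" "t \<in> J"
  shows "lo \<le> iterate \<phi> n t" "iterate \<phi> n t \<le> hi"
proof -
  have "lo \<le> iterate \<phi> n t \<and> iterate \<phi> n t \<le> hi"
    using assms(2)
  proof (induction n arbitrary: t)
    case (Suc n)
    show ?case using Suc.IH[OF greedy_map_mem_J[OF Suc.prems]] Suc.IH[OF lazy_map_mem_J[OF Suc.prems]]
      by (auto intro!: convex_bounds)
  qed (use assms(1) in simp)
  thus "lo \<le> iterate \<phi> n t" "iterate \<phi> n t \<le> hi" by auto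
qed

abbreviation below :: "real \<Rightarrow> real \<Rightarrow> real" where "below x t \<equiv> of_bool (x < t)"

text \<open>For \<open>t\<close> in \<open>J\<close> the digit \<open>\<beta> * t - T t\<close> is
  the number of greedy cells lying wholly below \<open>t\<close>; \<open>p\<close> is the
  probability of choosing the greedy map.\<close>

definition greedy_digit :: "real \<Rightarrow> real" where "greedy_digit t = p * (\<beta> * t - T t)"

definition lazy_digit :: "real \<Rightarrow> real" where "lazy_digit t = (1 - p) * (\<beta> * t - L t)"

lemma branch_less_iff: "branch d x < t \<longleftrightarrow> x + of_int d < \<beta> * t"
  using beta by (simp add: branch_def field_simps)

text \<open>Let \<open>D\<close> be the greedy digit of \<open>t\<close>. If \<open>x < 1\<close>,
  the branches with \<open>d < D\<close> put \<open>x\<close> below \<open>t\<close>, those with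
  \<open>d > D\<close> do not, and branch \<open>D\<close> does exactly when \<open>x < T t\<close>.
  If \<open>1 \<le> x\<close>, only the full top branch is present.\<close>

lemma greedy_branches_below:
  assumes "t \<in> J" "x \<in> J"
  shows "(\<Sum>d\<in>{0..top_digit}. of_bool (d = top_digit \<or> x < 1) * below (branch d x) t) =
    below x (T t) + (\<beta> * t - T t) * of_bool (x < 1)"
proof -
  obtain D where D: "D \<in> {0..top_digit}" "T t = \<beta> * t - of_int D" "T t \<in> J" "D = top_digit \<or> T t < 1"
    using assms(1) by (rule greedy_digitE)
  have bt: "\<beta> * t = T t + of_int D" using D by simp
  have x: "0 \<le> x" "0 \<le> T t" using assms D by (auto simp: mem_J_iff)
  show ?thesis
  proof (cases "x < 1")
    case True
    have "below (branch d x) t = (if d < D then 1 else if d = D then below x (T t) else 0)"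
      if "d \<in> {0..top_digit}" for d
    proof (cases d D rule: linorder_cases)
      case less
      hence "of_int d + 1 \<le> (of_int D :: real)" by linarith
      thus ?thesis using True less x unfolding branch_less_iff bt by simp
    next
      case greater
      hence "of_int D + 1 \<le> (of_int d :: real)" by linarith
      thus ?thesis using greater x D that unfolding branch_less_iff bt by auto
    qed (auto simp: branch_less_iff bt)
    hence "(\<Sum>d\<in>{0..top_digit}. of_bool (d = top_digit \<or> x < 1) * below (branch d x) t) =
      (\<Sum>d\<in>{0..top_digit}. if d < D then 1 else if d = D then below x (T t) else 0)"
      using True by (intro sum.cong) auto
    thus ?thesis using D True by (simp add: sum_digit_step bt)
  next
    case False
    hence "(\<Sum>d\<in>{0..top_digit}. of_bool (d = top_digit \<or> x < 1) * below (branch d x) t) =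
      (\<Sum>d\<in>{0..top_digit}. if d = top_digit then below (branch top_digit x) t else 0)"
      by (intro sum.cong) auto
    also have "\<dots> = of_bool (x + of_int top_digit < T t + of_int D)"
      using top_digit_ge_1 by (simp add: branch_less_iff bt)
    \<comment> \<open>When \<open>D\<close> is not the top digit, both sides are \<open>0\<close>,
      since \<open>T t < 1 \<le> x\<close>.\<close>
    also have "\<dots> = below x (T t)"
    proof (cases "D = top_digit")
      case True
      thus ?thesis by simp
    next
      case D': False
      hence "of_int D + 1 \<le> (of_int top_digit :: real)" using D(1) by auto
      thus ?thesis using D' D False by auto
    qed
    finally show ?thesis using False by simp
  qed
qed

text \<open>This mirrors \<open>greedy_branches_below\<close>: the digits separate for
  \<open>right_end - 1 < x\<close>, and for other \<open>x\<close> only the full branch of digit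
  \<open>0\<close> remains.\<close>

lemma lazy_branches_below:
  assumes "t \<in> J" "x \<in> J"
  shows "(\<Sum>d\<in>{0..top_digit}. of_bool (d = 0 \<or> right_end - 1 < x) * below (branch d x) t) =
    below x (L t) + (\<beta> * t - L t) * of_bool (right_end - 1 < x)"
proof -
  obtain D where D: "D \<in> {0..top_digit}" "L t = \<beta> * t - of_int D" "L t \<in> J" "D = 0 \<or> right_end - 1 < L t"
    using assms(1) by (rule lazy_digitE)
  have bt: "\<beta> * t = L t + of_int D" using D by simp
  have x: "x \<le> right_end" "L t \<le> right_end" using assms D by (auto simp: mem_J_iff)
  show ?thesis
  proof (cases "right_end - 1 < x")
    case True
    have "below (branch d x) t = (if d < D then 1 else if d = D then below x (L t) else 0)"
      if "d \<in> {0..top_digit}" for d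
    proof (cases d D rule: linorder_cases)
      case less
      hence "of_int d + 1 \<le> (of_int D :: real)" by linarith
      thus ?thesis using less x D that unfolding branch_less_iff bt by auto
    next
      case greater
      hence "of_int D + 1 \<le> (of_int d :: real)" by linarith
      thus ?thesis using True greater x unfolding branch_less_iff bt by auto
    qed (auto simp: branch_less_iff bt)
    hence "(\<Sum>d\<in>{0..top_digit}. of_bool (d = 0 \<or> right_end - 1 < x) * below (branch d x) t) =
      (\<Sum>d\<in>{0..top_digit}. if d < D then 1 else if d = D then below x (L t) else 0)"
      using True by (intro sum.cong) auto
    thus ?thesis using D True by (simp add: sum_digit_step bt)
  next
    case False
    hence "(\<Sum>d\<in>{0..top_digit}. of_bool (d = 0 \<or> right_end - 1 < x) * below (branch d x) t) =
      (\<Sum>d\<in>{0..top_digit}. if d = 0 then below (branch 0 x) t else 0)"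
      by (intro sum.cong) auto
    also have "\<dots> = of_bool (x < L t + of_int D)"
      using top_digit_ge_1 by (simp add: branch_less_iff bt)
    also have "\<dots> = below x (L t)"
    proof (cases "D = 0")
      case True
      thus ?thesis by simp
    next
      case D': False
      hence "1 \<le> (of_int D :: real)" using D(1) by auto
      thus ?thesis using D' D False by auto
    qed
    finally show ?thesis using False by simp
  qed
qed

lemma transfer_eq:
  "transfer h y =
    (p * (\<Sum>d\<in>{0..top_digit}. of_bool (d = top_digit \<or> y < 1) * h (branch d y)) +
     (1 - p) * (\<Sum>d\<in>{0..top_digit}. of_bool (d = 0 \<or> right_end - 1 < y) * h (branch d y))) / \<beta>"
  unfolding transfer_def sum_distrib_left sum.distrib[symmetric]
  by (intro arg_cong[where f = "\<lambda>z. z / \<beta>"] sum.cong refl) (simp only: distrib_right mult.assoc)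

lemma transfer_linear:
  "transfer (\<lambda>x. a * f x + b * g x) y = a * transfer f y + b * transfer g y"
proof -
  have "transfer (\<lambda>x. a * f x + b * g x) y = (\<Sum>d\<in>{0..top_digit}.
     a * ((p * of_bool (d = top_digit \<or> y < 1) + (1 - p) * of_bool (d = 0 \<or> right_end - 1 < y)) *
     f (branch d y)) +
     b * ((p * of_bool (d = top_digit \<or> y < 1) + (1 - p) * of_bool (d = 0 \<or> right_end - 1 < y)) *
     g (branch d y))) / \<beta>"
    unfolding transfer_def by (intro arg_cong[where f = "\<lambda>z. z / \<beta>"] sum.cong refl) (simp only: distrib_left mult_ac)
  thus ?thesis
    unfolding transfer_def sum.distrib sum_distrib_left[symmetric] by (simp add: add_divide_distrib)
qed

text \<open>The two branch counts settle \<open>n = 0\<close>. For the induction step,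
  \<open>iterate\<close> is a mixture over the starting points \<open>T t\<close> and
  \<open>L t\<close>, and \<open>transfer\<close> is linear.\<close>

lemma transfer_iterate_below:
  assumes "t \<in> J" "x \<in> J"
  shows "transfer (\<lambda>x. iterate (below x) n t) x =
    (iterate (below x) (Suc n) t + iterate greedy_digit n t * of_bool (x < 1) +
      iterate lazy_digit n t * of_bool (right_end - 1 < x)) / \<beta>"
  using assms(1)
proof (induction n arbitrary: t)
  case 0
  show ?case
    unfolding transfer_eq iterate.simps greedy_branches_below[OF 0 assms(2)] lazy_branches_below[OF 0 assms(2)]
      greedy_digit_def lazy_digit_def
    by (simp only: distrib_left mult.assoc add_ac)
next
  case (Suc n)
  note IH = Suc.IH[OF greedy_map_mem_J[OF Suc.prems]] Suc.IH[OF lazy_map_mem_J[OF Suc.prems]]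
  have "p * ((a + b * u + c * v) / \<beta>) + (1 - p) * ((a' + b' * u + c' * v) / \<beta>) =
    (p * a + (1 - p) * a' + (p * b + (1 - p) * b') * u + (p * c + (1 - p) * c') * v) / \<beta>"
    for a b c a' b' c' u v :: real
    unfolding times_divide_eq_right add_divide_distrib[symmetric]
    by (rule arg_cong[where f = "\<lambda>z. z / \<beta>"]) (simp add: algebra_simps)
  thus ?case
    unfolding iterate.simps(2)[of "below _" n t] transfer_linear IH
      iterate.simps(2)[of "below x" "Suc n" t] iterate.simps(2)[of greedy_digit] iterate.simps(2)[of lazy_digit] .
qed

section \<open>Discounted sums along the random orbit\<close>

lemma digit_bounds:
  assumes "t \<in> J"
  shows "0 \<le> greedy_digit t \<and> greedy_digit t \<le> p * of_int top_digit"
    and "0 \<le> lazy_digit t \<and> lazy_digit t \<le> (1 - p) * of_int top_digit"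
proof -
  have D: "0 \<le> (of_int D :: real) \<and> (of_int D :: real) \<le> of_int top_digit" if "D \<in> {0..top_digit}" for D
    using that by auto
  show "0 \<le> greedy_digit t \<and> greedy_digit t \<le> p * of_int top_digit"
    unfolding greedy_digit_def by (rule greedy_digitE[OF assms]) (use D p in \<open>auto intro!: mult_left_mono\<close>)
  show "0 \<le> lazy_digit t \<and> lazy_digit t \<le> (1 - p) * of_int top_digit"
    unfolding lazy_digit_def by (rule lazy_digitE[OF assms]) (use D p in \<open>auto intro!: mult_left_mono\<close>)
qed

text \<open>The Neumann series of the inverse of \<open>1 - Q / \<beta>\<close>, applied to
  \<open>\<phi>\<close>.\<close>

definition resolvent :: "(real \<Rightarrow> real) \<Rightarrow> real \<Rightarrow> real" where
  "resolvent \<phi> t = (\<Sum>n. iterate \<phi> n t / \<beta> ^ n)"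

lemma inverse_power_sums: "(\<lambda>n. c / \<beta> ^ n) sums (c * \<beta> / (\<beta> - 1))"
proof -
  have "(\<lambda>n. (1 / \<beta>) ^ n) sums (1 / (1 - 1 / \<beta>))" using beta by (intro geometric_sums) auto
  hence "(\<lambda>n. c * (1 / \<beta>) ^ n) sums (c * (1 / (1 - 1 / \<beta>)))" by (rule sums_mult)
  thus ?thesis using beta by (simp add: field_simps power_one_over)
qed

lemma resolvent_sums:
  assumes "\<And>t. t \<in> J \<Longrightarrow> lo \<le> \<phi> t \<and> \<phi> t \<le> hi" "t \<in> J"
  shows "(\<lambda>n. iterate \<phi> n t / \<beta> ^ n) sums resolvent \<phi> t"
  unfolding resolvent_def
proof (rule summable_sums, rule summable_comparison_test', rule sums_summable[OF inverse_power_sums])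
  fix n :: nat
  show "norm (iterate \<phi> n t / \<beta> ^ n) \<le> max \<bar>lo\<bar> \<bar>hi\<bar> / \<beta> ^ n" if "n \<ge> 0"
  proof -
    have "\<bar>iterate \<phi> n t\<bar> \<le> max \<bar>lo\<bar> \<bar>hi\<bar>"
      using iterate_bounds[of lo \<phi> hi t n, OF assms] by linarith
    thus ?thesis using beta by (simp add: divide_right_mono)
  qed
qed

lemma resolvent_bounds:
  assumes "\<And>t. t \<in> J \<Longrightarrow> lo \<le> \<phi> t \<and> \<phi> t \<le> hi" "t \<in> J"
  shows "lo * \<beta> / (\<beta> - 1) \<le> resolvent \<phi> t" "resolvent \<phi> t \<le> hi * \<beta> / (\<beta> - 1)"
proof -
  show "lo * \<beta> / (\<beta> - 1) \<le> resolvent \<phi> t"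
    by (rule sums_le[OF _ inverse_power_sums resolvent_sums[OF assms]])
       (use iterate_bounds[of lo \<phi> hi t, OF assms] beta in \<open>auto intro!: divide_right_mono\<close>)
  show "resolvent \<phi> t \<le> hi * \<beta> / (\<beta> - 1)"
    by (rule sums_le[OF _ resolvent_sums[OF assms] inverse_power_sums])
       (use iterate_bounds[of lo \<phi> hi t, OF assms] beta in \<open>auto intro!: divide_right_mono\<close>)
qed

lemma resolvent_unfold:
  assumes "\<And>t. t \<in> J \<Longrightarrow> lo \<le> \<phi> t \<and> \<phi> t \<le> hi" "t \<in> J"
  shows "resolvent \<phi> t = \<phi> t + (p * resolvent \<phi> (T t) + (1 - p) * resolvent \<phi> (L t)) / \<beta>"
proof -
  have "(\<lambda>n. iterate \<phi> (Suc n) t / \<beta> ^ Suc n) sums (resolvent \<phi> t - \<phi> t)"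
    using resolvent_sums[OF assms] by (subst sums_Suc_iff) simp
  moreover have "(\<lambda>n. (p * (iterate \<phi> n (T t) / \<beta> ^ n) + (1 - p) * (iterate \<phi> n (L t) / \<beta> ^ n)) / \<beta>)
      sums ((p * resolvent \<phi> (T t) + (1 - p) * resolvent \<phi> (L t)) / \<beta>)"
    using assms by (intro sums_divide sums_add sums_mult resolvent_sums[where lo = lo and hi = hi])
      (auto simp: greedy_map_mem_J lazy_map_mem_J)
  moreover have "(\<lambda>n. (p * (iterate \<phi> n (T t) / \<beta> ^ n) + (1 - p) * (iterate \<phi> n (L t) / \<beta> ^ n)) / \<beta>) =
      (\<lambda>n. iterate \<phi> (Suc n) t / \<beta> ^ Suc n)"
    by (simp add: add_divide_distrib mult.commute)
  ultimately have "resolvent \<phi> t - \<phi> t = (p * resolvent \<phi> (T t) + (1 - p) * resolvent \<phi> (L t)) / \<beta>"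
    using sums_unique2 by metis
  thus ?thesis by simp
qed

text \<open>\<open>H t x = (\<Sum>n. \<beta>\<^sup>-\<^sup>n Pr (x < t\<^sub>n))\<close> for the random orbit \<open>t\<^sub>n\<close> of \<open>t\<close>.\<close>

abbreviation H :: "real \<Rightarrow> real \<Rightarrow> real" where "H t x \<equiv> resolvent (below x) t"

text \<open>The term \<open>n = 0\<close> is the indicator itself; the remaining terms sum to at
  most \<open>1 / (\<beta> - 1)\<close>. The lower bound later makes the density positive.\<close>

lemma H_bounds:
  assumes "t \<in> J"
  shows "below x t \<le> H t x" "H t x \<le> below x t + 1 / (\<beta> - 1)"
proof -
  have b: "0 \<le> H s x" "H s x \<le> \<beta> / (\<beta> - 1)" if "s \<in> J" for s
    using resolvent_bounds[of 0 "below x" 1 s] that by auto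
  note c = convex_bounds[OF b[OF greedy_map_mem_J[OF assms]] b[OF lazy_map_mem_J[OF assms]]]
  have "0 \<le> (p * H (T t) x + (1 - p) * H (L t) x) / \<beta>"
    "(p * H (T t) x + (1 - p) * H (L t) x) / \<beta> \<le> (\<beta> / (\<beta> - 1)) / \<beta>"
    using c beta by (auto intro!: divide_nonneg_pos simp del: divide_divide_eq_left intro: divide_right_mono)
  moreover have "H t x = below x t + (p * H (T t) x + (1 - p) * H (L t) x) / \<beta>"
    using assms by (intro resolvent_unfold[of 0 _ 1]) auto
  ultimately show "below x t \<le> H t x" "H t x \<le> below x t + 1 / (\<beta> - 1)" using beta by auto
qed

lemma H_measurable: "H t \<in> borel_measurable borel"
proof -
  have [measurable]: "(\<lambda>x. iterate (below x) n t) \<in> borel_measurable borel" for n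
    by (induction n arbitrary: t) simp_all
  show ?thesis unfolding resolvent_def by measurable
qed

text \<open>Dividing \<open>transfer_iterate_below\<close> by \<open>\<beta> ^ n\<close> and summing
  shifts the index by one, which costs the initial term \<open>below x t\<close>.\<close>

lemma transfer_H:
  assumes "t \<in> J" "x \<in> J"
  shows "transfer (H t) x = H t x - below x t + resolvent greedy_digit t / \<beta> * of_bool (x < 1) +
    resolvent lazy_digit t / \<beta> * of_bool (right_end - 1 < x)"
proof -
  have "(\<lambda>n. transfer (\<lambda>x. iterate (below x) n t / \<beta> ^ n) x) sums transfer (H t) x"
    unfolding transfer_def
    by (intro sums_divide sums_sum sums_mult resolvent_sums[of 0 _ 1] assms) auto
  moreover have "transfer (\<lambda>x. iterate (below x) n t / \<beta> ^ n) x =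
      iterate (below x) (Suc n) t / \<beta> ^ Suc n + (iterate greedy_digit n t / \<beta> ^ n) / \<beta> * of_bool (x < 1) +
      (iterate lazy_digit n t / \<beta> ^ n) / \<beta> * of_bool (right_end - 1 < x)" for n
  proof -
    have "transfer (\<lambda>x. iterate (below x) n t / \<beta> ^ n) x = 1 / \<beta> ^ n * transfer (\<lambda>x. iterate (below x) n t) x"
      using transfer_linear[of "1 / \<beta> ^ n" "\<lambda>x. iterate (below x) n t" 0] by simp
    thus ?thesis unfolding transfer_iterate_below[OF assms] using beta by (simp add: field_simps)
  qed
  ultimately have "(\<lambda>n. iterate (below x) (Suc n) t / \<beta> ^ Suc n + (iterate greedy_digit n t / \<beta> ^ n) / \<beta> * of_bool (x < 1) +
      (iterate lazy_digit n t / \<beta> ^ n) / \<beta> * of_bool (right_end - 1 < x)) sums transfer (H t) x"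
    by (simp only:)
  moreover have "(\<lambda>n. iterate (below x) (Suc n) t / \<beta> ^ Suc n) sums (H t x - below x t)"
    using resolvent_sums[of 0 "below x" 1 t] assms by (subst sums_Suc_iff) simp
  hence "(\<lambda>n. iterate (below x) (Suc n) t / \<beta> ^ Suc n + (iterate greedy_digit n t / \<beta> ^ n) / \<beta> * of_bool (x < 1) +
      (iterate lazy_digit n t / \<beta> ^ n) / \<beta> * of_bool (right_end - 1 < x)) sums
    (H t x - below x t + resolvent greedy_digit t / \<beta> * of_bool (x < 1) +
    resolvent lazy_digit t / \<beta> * of_bool (right_end - 1 < x))"
    by (intro sums_add sums_mult2 sums_divide resolvent_sums[OF digit_bounds(1)] resolvent_sums[OF digit_bounds(2)] assms)
  ultimately show ?thesis by (rule sums_unique2)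
qed

text \<open>The random expansion of \<open>t\<close> in base \<open>\<beta>\<close>: each digit is
  \<open>\<beta>\<close> times the current point minus the next one, so the discounted digits
  telescope to \<open>t\<close>.\<close>

lemma resolvent_digits:
  assumes "t \<in> J"
  shows "resolvent greedy_digit t / \<beta> + resolvent lazy_digit t / \<beta> = t"
proof -
  have eq: "iterate greedy_digit n t + iterate lazy_digit n t =
      \<beta> * iterate (\<lambda>t. t) n t - iterate (\<lambda>t. t) (Suc n) t" for n
  proof (induction n arbitrary: t)
    case (Suc n)
    show ?case
      using Suc.IH[of "T t", THEN arg_cong[where f = "\<lambda>z. p * z"]]
        Suc.IH[of "L t", THEN arg_cong[where f = "\<lambda>z. (1 - p) * z"]]
      by (simp add: algebra_simps)
  qed (simp add: algebra_simps greedy_digit_def lazy_digit_def)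
  have "(\<lambda>n. iterate (\<lambda>t. t) n t / \<beta> ^ n) \<longlonglongrightarrow> 0"
    by (rule summable_LIMSEQ_zero[OF sums_summable[OF resolvent_sums[of 0 "\<lambda>t. t" right_end]]])
      (use assms in \<open>auto simp: mem_J_iff\<close>)
  from telescope_sums'[OF this]
  have "(\<lambda>n. iterate (\<lambda>t. t) n t / \<beta> ^ n - iterate (\<lambda>t. t) (Suc n) t / \<beta> ^ Suc n) sums t"
    by (simp only: iterate.simps(1) power_0 div_by_1 diff_zero)
  moreover have "iterate (\<lambda>t. t) n t / \<beta> ^ n - iterate (\<lambda>t. t) (Suc n) t / \<beta> ^ Suc n =
      iterate greedy_digit n t / \<beta> ^ n / \<beta> + iterate lazy_digit n t / \<beta> ^ n / \<beta>" for n
  proof -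
    have "iterate greedy_digit n t / \<beta> ^ n / \<beta> + iterate lazy_digit n t / \<beta> ^ n / \<beta> =
        (iterate greedy_digit n t + iterate lazy_digit n t) / \<beta> ^ Suc n"
      by (simp add: add_divide_distrib mult.commute)
    thus ?thesis unfolding eq using beta by (simp add: diff_divide_distrib)
  qed
  moreover have "(\<lambda>n. iterate greedy_digit n t / \<beta> ^ n / \<beta> + iterate lazy_digit n t / \<beta> ^ n / \<beta>) sums
      (resolvent greedy_digit t / \<beta> + resolvent lazy_digit t / \<beta>)"
    by (intro sums_add sums_divide resolvent_sums[OF digit_bounds(1)] resolvent_sums[OF digit_bounds(2)] assms)
  ultimately show ?thesis by (simp only:) (rule sums_unique2)
qed


section \<open>Positivity and construction of the invariant density\<close>

lemma transfer_const:
  assumes "x \<in> J"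
  shows "transfer (\<lambda>_. 1) x =
    (1 + p * of_int top_digit * of_bool (x < 1) + (1 - p) * of_int top_digit * of_bool (right_end - 1 < x)) / \<beta>"
proof -
  have "(\<Sum>d\<in>{0..top_digit}. of_bool (d = e \<or> A) :: real) = 1 + of_int top_digit * of_bool A"
    if e: "e \<in> {0..top_digit}" for e A
  proof (cases A)
    case False
    have "(\<Sum>d\<in>{0..top_digit}. of_bool (d = e) :: real) = (\<Sum>d\<in>{0..top_digit}. if d = e then 1 else 0)"
      by (intro sum.cong) auto
    thus ?thesis using e False by simp
  qed (use e in simp)
  from this[of top_digit "x < 1"] this[of 0 "right_end - 1 < x"] show ?thesis
    using top_digit_ge_1 unfolding transfer_eq by (simp add: algebra_simps)
qed

text \<open>The two end branches are present in \<open>transfer\<close> at every point, with weight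
  at least \<open>1 - p\<close> for digit \<open>0\<close> and \<open>p\<close> for the top digit.
  Keeping this single term and iterating bounds \<open>h y\<close> from below by a value of
  \<open>h\<close> near the fixed point of the branch.\<close>

lemma branch_power_lower_bound:
  assumes h: "\<And>x. x \<in> J \<Longrightarrow> 0 \<le> h x" "\<And>x. x \<in> J \<Longrightarrow> transfer h x \<le> h x"
    and q: "d = top_digit \<and> q = p \<or> d = 0 \<and> q = 1 - p" and y: "y \<in> J"
  shows "(branch d ^^ n) y \<in> J \<and> (q / \<beta>) ^ n * h ((branch d ^^ n) y) \<le> h y"
proof (induction n)
  case (Suc n)
  let ?z = "(branch d ^^ n) y"
  let ?w = "\<lambda>d. p * of_bool (d = top_digit \<or> ?z < 1) + (1 - p) * of_bool (d = 0 \<or> right_end - 1 < ?z)"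
  have d: "d \<in> {0..top_digit}" using q top_digit_ge_1 by auto
  have z: "?z \<in> J" using Suc.IH by blast
  have "q * h (branch d ?z) / \<beta> \<le> ?w d * h (branch d ?z) / \<beta>"
    using q p beta h(1)[OF branch_mem_J[OF z d]] by (intro divide_right_mono mult_right_mono) auto
  also have "\<dots> \<le> transfer h ?z"
    unfolding transfer_def using p beta d h(1)[OF branch_mem_J[OF z]]
    by (intro divide_right_mono member_le_sum[where f = "\<lambda>d. ?w d * h (branch d ?z)"]) auto
  also have "\<dots> \<le> h ?z" by (rule h(2)[OF z])
  finally have "(q / \<beta>) ^ n * (q * h (branch d ?z) / \<beta>) \<le> (q / \<beta>) ^ n * h ?z"
    using q p beta by (intro mult_left_mono) auto
  also have "\<dots> \<le> h y" using Suc.IH by blast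
  finally show ?case using branch_mem_J[OF z d] by (simp add: mult_ac)
qed (use y in simp)

lemma branch_0_power: "(branch 0 ^^ n) y = y / \<beta> ^ n"
  by (induction n) (simp_all add: branch_def)

lemma branch_top_power: "right_end - (branch top_digit ^^ n) y = (right_end - y) / \<beta> ^ n"
proof (induction n)
  case (Suc n)
  have "right_end - branch top_digit z = (right_end - z) / \<beta>" for z
    using beta beta_right_end by (simp add: branch_def field_simps)
  thus ?case using Suc by simp
qed simp

text \<open>Both branches contract by \<open>1 / \<beta>\<close> towards their fixed points
  \<open>0\<close> and \<open>right_end\<close>, so a single \<open>n\<close> with
  \<open>right_end < \<beta> ^ n\<close> serves all of \<open>J\<close>.\<close>

lemma branch_power_near_fixed_point:
  obtains n where "\<And>y. y \<in> J \<Longrightarrow> (branch 0 ^^ n) y < 1"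
    "\<And>y. y \<in> J \<Longrightarrow> right_end - 1 < (branch top_digit ^^ n) y"
proof -
  obtain n where n: "right_end < \<beta> ^ n" using real_arch_pow beta by blast
  have *: "z / \<beta> ^ n < 1" if "z \<le> right_end" for z
    using that n beta by (subst divide_less_eq_1_pos) auto
  have "right_end - 1 < (branch top_digit ^^ n) y" if "y \<in> J" for y
    using *[of "right_end - y"] that branch_top_power[of n y] by (auto simp: mem_J_iff)
  moreover have "(branch 0 ^^ n) y < 1" if "y \<in> J" for y
    using *[of y] that by (auto simp: mem_J_iff branch_0_power)
  ultimately show ?thesis using that by blast
qed

text \<open>The density is \<open>k H 1 + \<gamma> (C - H s)\<close> with \<open>s = a - 1\<close>, where \<open>C - H s\<close> is the discounted sum of the
  indicators of \<open>[s\<^sub>n, a]\<close>. These are closed at \<open>s\<^sub>n\<close>, whence the exceptional point \<open>a - 1\<close>. If \<open>\<gamma> = 0\<close>,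
  the weight \<open>k\<close> may vanish as well, but then \<open>H 1\<close> itself is invariant.\<close>

lemma stationary_density_exists:
  obtains h B c where "h \<in> borel_measurable borel" "\<And>x. 0 \<le> h x" "\<And>x. h x \<le> B"
    "c > 0" "\<And>x. x \<in> J \<Longrightarrow> c \<le> h x"
    "\<And>x. x \<in> J \<Longrightarrow> x \<noteq> right_end - 1 \<Longrightarrow> transfer h x = h x"
proof -
  \<comment> \<open>\<open>rg t\<close> and \<open>rl t\<close> are the coefficients of the
    indicators of \<open>x < 1\<close> and \<open>right_end - 1 < x\<close> in
    \<open>transfer_H\<close>.\<close>
  define rg where "rg t = resolvent greedy_digit t / \<beta>" for t
  define rl where "rl t = resolvent lazy_digit t / \<beta>" for t
  define C where "C = \<beta> / (\<beta> - 1)"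
  define s where "s = right_end - 1"
  have J: "1 \<in> J" "s \<in> J" using right_end_gt_1 by (auto simp: mem_J_iff s_def)
  have sum: "rg t + rl t = t" if "t \<in> J" for t
    using resolvent_digits[OF that] by (simp add: rg_def rl_def)
  have C: "C = 1 + 1 / (\<beta> - 1)" "C > 0" using beta by (auto simp: C_def field_simps)
  have rl: "rl 1 \<ge> 0" 
    using resolvent_bounds(1)[OF digit_bounds(2) J(1)] beta by (simp add: rl_def)
  have "resolvent greedy_digit s \<le> p * of_int top_digit * \<beta> / (\<beta> - 1)"
    by (rule resolvent_bounds(2)[OF digit_bounds(1) J(2)])
  hence "rg s \<le> p * of_int top_digit * \<beta> / (\<beta> - 1) / \<beta>"
    unfolding rg_def using beta by (intro divide_right_mono) auto
  hence rg: "rg s \<le> p * right_end" using beta by (simp add: right_end_def)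
  have H: "0 \<le> H t x" "H t x \<le> C" "below x t \<le> H t x" "1 - below x t \<le> C - H t x" if "t \<in> J" for t x
    using H_bounds[OF that, of x] beta unfolding C(1) by (cases "x < t"; simp; smt (verit) divide_nonneg_nonneg)+
  obtain n where n: "\<And>y. y \<in> J \<Longrightarrow> (branch 0 ^^ n) y < 1"
    "\<And>y. y \<in> J \<Longrightarrow> right_end - 1 < (branch top_digit ^^ n) y"
    by (rule branch_power_near_fixed_point) blast
  show ?thesis
  proof (cases "rl 1 = 0")
    case True
    hence "rg 1 = 1" using sum[OF J(1)] by simp
    hence tr: "transfer (H 1) x = H 1 x" if "x \<in> J" for x
      using True unfolding transfer_H[OF J(1) that] rg_def[symmetric] rl_def[symmetric] by simp
    show ?thesis
    proof (rule that[of "H 1" C "((1 - p) / \<beta>) ^ n"])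
      fix x assume x: "x \<in> J"
      have "((1 - p) / \<beta>) ^ n * H 1 ((branch 0 ^^ n) x) \<le> H 1 x"
        using branch_power_lower_bound[of "H 1" 0 "1 - p" x n] H[OF J(1)] tr x by simp
      moreover have "((1 - p) / \<beta>) ^ n * 1 \<le> ((1 - p) / \<beta>) ^ n * H 1 ((branch 0 ^^ n) x)"
        using H(3)[OF J(1), of "(branch 0 ^^ n) x"] n(1)[OF x] p beta by (intro mult_left_mono) auto
      ultimately show "((1 - p) / \<beta>) ^ n \<le> H 1 x" by simp
    qed (use H[OF J(1)] H_measurable tr p beta in auto)
  next
    case False
    hence rl: "rl 1 > 0" using rl by simp
    \<comment> \<open>Away from the point \<open>s\<close>, \<open>transfer\<close> adds
      \<open>rl 1 * (v - u)\<close> to \<open>H 1\<close> and \<open>k * (u - v)\<close> to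
      \<open>C - H s\<close>, where \<open>u\<close> and \<open>v\<close> are the indicators of
      \<open>x < 1\<close> and \<open>s < x\<close>. The weights \<open>k\<close> and
      \<open>rl 1\<close> make these changes cancel.\<close>
    define k where "k = p * right_end - rg s"
    define h where "h x = k * H 1 x + rl 1 * (C - H s x)" for x
    have k: "k \<ge> 0" using rg by (simp add: k_def)
    have tr: "transfer h x = h x + rl 1 * (of_bool (s < x) - (1 - below x s))" if x: "x \<in> J" for x
    proof -
      have C1: "transfer (\<lambda>x. 1) x * C =
          1 / (\<beta> - 1) + p * right_end * of_bool (x < 1) + (1 - p) * right_end * of_bool (s < x)"
      proof -
        have div: "z / \<beta> * (\<beta> / (\<beta> - 1)) = z / (\<beta> - 1)" for z using beta by simp
        show ?thesis unfolding transfer_const[OF x] C_def s_def div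
          by (simp only: add_divide_distrib right_end_def times_divide_eq_left times_divide_eq_right)
      qed
      have "transfer h x = k * transfer (H 1) x + rl 1 * (C * transfer (\<lambda>x. 1) x + (-1) * transfer (H s) x)"
        using transfer_linear[of k "H 1" "rl 1" "\<lambda>x. C * 1 + (-1) * H s x" x] transfer_linear[of C "\<lambda>x. 1" "-1" "H s" x]
        unfolding h_def by simp
      also have "\<dots> = k * (H 1 x - of_bool (x < 1) + rg 1 * of_bool (x < 1) + rl 1 * of_bool (s < x)) +
          rl 1 * (1 / (\<beta> - 1) + p * right_end * of_bool (x < 1) + (1 - p) * right_end * of_bool (s < x) -
            (H s x - below x s + rg s * of_bool (x < 1) + rl s * of_bool (s < x)))"
        unfolding transfer_H[OF J(1) x, folded rg_def rl_def s_def] transfer_H[OF J(2) x, folded rg_def rl_def s_def]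
          mult.commute[of C] C1 by simp
      also have "\<dots> = h x + rl 1 * (of_bool (s < x) - (1 - below x s))"
      proof -
        have e: "rg 1 = 1 - rl 1" "rl s = right_end - 1 - rg s"
          using sum[OF J(1)] sum[OF J(2)] by (auto simp: s_def)
        have c: "1 / (\<beta> - 1) = C - 1" using C by simp
        show ?thesis unfolding h_def k_def e c
          by (cases "x < 1"; cases "s < x") (simp_all add: algebra_simps)
      qed
      finally show ?thesis .
    qed
    have h: "0 \<le> h x" "rl 1 * (1 - below x s) \<le> h x" for x
    proof -
      have "rl 1 * (1 - below x s) \<le> rl 1 * (C - H s x)" "0 \<le> k * H 1 x"
        using H[OF J(2), of x] H[OF J(1), of x] k rl by (auto intro!: mult_left_mono)
      moreover have "0 \<le> rl 1 * (1 - below x s)" using rl by simp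
      ultimately show "0 \<le> h x" "rl 1 * (1 - below x s) \<le> h x" unfolding h_def by linarith+
    qed
    show ?thesis
    proof (rule that[of h "k * C + rl 1 * C" "(p / \<beta>) ^ n * rl 1"])
      show "h \<in> borel_measurable borel"
        unfolding h_def by (intro borel_measurable_add borel_measurable_times borel_measurable_diff
          borel_measurable_const H_measurable)
      show "h x \<le> k * C + rl 1 * C" for x
        unfolding h_def using H[OF J(2), of x] H[OF J(1), of x] k rl
        by (intro add_mono mult_left_mono) auto
      show "transfer h x = h x" if "x \<in> J" "x \<noteq> right_end - 1" for x
        using tr that by (auto simp: s_def)
      fix x assume x: "x \<in> J"
      \<comment> \<open>At \<open>x = s\<close> the defect is \<open>- rl 1\<close>, so the
        inequality holds at the exceptional point too.\<close>
      have "transfer h x \<le> h x" if "x \<in> J" for x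
        unfolding tr[OF that] using rl by (cases "x < s"; cases "s < x") auto
      hence "(p / \<beta>) ^ n * h ((branch top_digit ^^ n) x) \<le> h x"
        using branch_power_lower_bound[of h top_digit p x n] h x by simp
      moreover have "(p / \<beta>) ^ n * rl 1 \<le> (p / \<beta>) ^ n * h ((branch top_digit ^^ n) x)"
        using h(2)[of "(branch top_digit ^^ n) x"] n(2)[OF x] p beta
        by (intro mult_left_mono) (auto simp: s_def)
      ultimately show "(p / \<beta>) ^ n * rl 1 \<le> h x" by simp
    qed (use h p beta rl in auto)
  qed
qed

section \<open>The stationary measure on the interval\<close>

abbreviation lam :: "real measure" where "lam \<equiv> normalized_lebesgue \<beta>"

lemma sets_lam [measurable_cong]: "sets lam = sets (restrict_space borel J)"
  by (rule sets_normalized_lebesgue)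

lemma prob_space_lam: "prob_space lam"
  using beta by (intro prob_space_normalized_lebesgue) simp

lemma emeasure_lborel_J: "emeasure lborel J = ennreal right_end"
  using right_end_gt_1 by (simp add: expansion_interval_def right_end_def top_digit_def)

lemma nn_integral_lam:
  assumes "f \<in> borel_measurable lam"
  shows "(\<integral>\<^sup>+x. f x \<partial>lam) = (\<integral>\<^sup>+x. f x * indicator J x \<partial>lborel) / ennreal right_end"
proof -
  let ?R = "restrict_space lborel J"
  have e: "emeasure ?R J = ennreal right_end"
    by (subst emeasure_restrict_space) (auto simp: emeasure_lborel_J)
  have "f \<in> borel_measurable ?R"
    using assms by (simp cong: measurable_cong_sets add: sets_lam sets_restrict_space)
  hence "(\<integral>\<^sup>+x. f x \<partial>lam) = (\<integral>\<^sup>+x. f x * indicator J x \<partial>?R) / ennreal right_end"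
    unfolding normalized_lebesgue_def by (subst nn_integral_uniform_measure) (auto simp: e sets_restrict_space)
  also have "(\<integral>\<^sup>+x. f x * indicator J x \<partial>?R) = (\<integral>\<^sup>+x. f x * indicator J x * indicator J x \<partial>lborel)"
    by (rule nn_integral_restrict_space) simp
  also have "\<dots> = (\<integral>\<^sup>+x. f x * indicator J x \<partial>lborel)"
    by (intro nn_integral_cong) (simp split: split_indicator)
  finally show ?thesis .
qed

lemma AE_lam_iff: "(AE x in lam. P x) \<longleftrightarrow> (AE x in lborel. x \<in> J \<longrightarrow> P x)"
proof -
  have e: "emeasure (restrict_space lborel J) J = ennreal right_end"
    by (subst emeasure_restrict_space) (auto simp: emeasure_lborel_J)
  have "(AE x in lam. P x) \<longleftrightarrow> (AE x in restrict_space lborel J. x \<in> J \<longrightarrow> P x)"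
    unfolding normalized_lebesgue_def using right_end_gt_1
    by (intro AE_uniform_measure) (simp_all add: e)
  also have "\<dots> \<longleftrightarrow> (AE x in lborel. x \<in> J \<longrightarrow> P x)"
    by (subst AE_restrict_space_iff) auto
  finally show ?thesis .
qed

text \<open>The invariant density is normalised. Its positive lower bound gives the null sets of
  \<open>lam\<close>, and \<open>transfer_duality\<close> turns its invariance into stationarity,
  the exceptional point being Lebesgue null.\<close>

lemma stationary_measure_exists:
  obtains \<mu> where "prob_space \<mu>" "sets \<mu> = sets lam" "null_sets \<mu> = null_sets lam"
    "\<And>F. F \<in> borel_measurable lam \<Longrightarrow>
      (\<integral>\<^sup>+x. ennreal p * F (T x) + ennreal (1 - p) * F (L x) \<partial>\<mu>) = (\<integral>\<^sup>+x. F x \<partial>\<mu>)"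
proof -
  obtain h B c where h [measurable]: "h \<in> borel_measurable borel" and h0: "\<And>x. 0 \<le> h x" "\<And>x. h x \<le> B"
    and c: "c > 0" "\<And>x. x \<in> J \<Longrightarrow> c \<le> h x"
    and tr: "\<And>x. x \<in> J \<Longrightarrow> x \<noteq> right_end - 1 \<Longrightarrow> transfer h x = h x"
    by (rule stationary_density_exists) blast
  interpret lam: prob_space lam by (rule prob_space_lam)
  have Jlam: "J \<in> sets lam" using sets.top[of lam] by simp
  have lam1: "emeasure lam J = 1" using lam.emeasure_space_1 by simp
  have hl [measurable]: "h \<in> borel_measurable lam"
    by (subst measurable_cong_sets[OF sets_lam refl]) (rule measurable_restrict_space1[OF h])
  define C where "C = (\<integral>\<^sup>+x. ennreal (h x) \<partial>lam)"
  have "(\<integral>\<^sup>+x. ennreal c \<partial>lam) \<le> C"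
    unfolding C_def by (intro nn_integral_mono) (auto intro!: ennreal_leI c(2))
  hence C0: "C > 0"
    using c(1) by (intro order_less_le_trans[of 0 "ennreal c" C]) (simp_all add: lam1)
  have "C \<le> (\<integral>\<^sup>+x. ennreal B \<partial>lam)"
    unfolding C_def by (intro nn_integral_mono) (auto intro!: ennreal_leI h0(2))
  hence C1: "C < \<top>" by (intro order_le_less_trans[of C "ennreal B"]) (simp_all add: lam1)
  define \<mu> where "\<mu> = density lam (\<lambda>x. ennreal (h x) / C)"
  have [measurable_cong]: "sets \<mu> = sets lam" by (simp add: \<mu>_def)
  have int: "(\<integral>\<^sup>+x. G x \<partial>\<mu>) = (\<integral>\<^sup>+x. G x * ennreal (h x) * indicator J x \<partial>lborel) / ennreal right_end / C"
    if [measurable]: "G \<in> borel_measurable lam" for G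
  proof -
    have "(\<integral>\<^sup>+x. G x \<partial>\<mu>) = (\<integral>\<^sup>+x. G x * ennreal (h x) / C \<partial>lam)"
      unfolding \<mu>_def by (subst nn_integral_density) (auto simp: mult_ac ennreal_times_divide)
    also have "\<dots> = (\<integral>\<^sup>+x. G x * ennreal (h x) \<partial>lam) / C"
      by (rule nn_integral_divide) simp
    finally show ?thesis by (subst (asm) nn_integral_lam) auto
  qed
  show ?thesis
  proof (rule that[of \<mu>])
    show "prob_space \<mu>"
    proof
      have "emeasure \<mu> (space \<mu>) = (\<integral>\<^sup>+x. ennreal (h x) / C \<partial>lam)"
        unfolding \<mu>_def by (subst emeasure_density) (auto intro!: nn_integral_cong simp: indicator_def Jlam)
      also have "\<dots> = C / C" unfolding C_def by (rule nn_integral_divide) simp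
      finally show "emeasure \<mu> (space \<mu>) = 1" using C0 C1 by simp
    qed
    show "sets \<mu> = sets lam" by fact
    have pos: "ennreal (h x) / C \<noteq> 0" if "x \<in> J" for x
    proof -
      have "h x > 0" using c(2)[OF that] c(1) by linarith
      thus ?thesis using C1 by (auto simp: ennreal_divide_eq_0_iff)
    qed
    show "null_sets \<mu> = null_sets lam"
    proof (rule set_eqI)
      fix A
      have "A \<in> null_sets \<mu> \<longleftrightarrow> A \<in> sets lam \<and> (AE x in lam. x \<in> A \<longrightarrow> ennreal (h x) / C = 0)"
        unfolding \<mu>_def by (rule null_sets_density_iff) measurable
      also have "\<dots> \<longleftrightarrow> A \<in> sets lam \<and> (AE x in lam. x \<notin> A)"
        using pos by (intro conj_cong refl AE_cong) auto
      also have "\<dots> \<longleftrightarrow> A \<in> null_sets lam"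
        by (auto simp: AE_iff_null_sets intro: AE_not_in)
      finally show "A \<in> null_sets \<mu> \<longleftrightarrow> A \<in> null_sets lam" .
    qed
    fix F :: "real \<Rightarrow> ennreal" assume F [measurable]: "F \<in> borel_measurable lam"
    have [measurable]: "T \<in> measurable lam lam" "L \<in> measurable lam lam"
      using maps_measurable by (simp_all cong: measurable_cong_sets add: sets_lam)
    \<comment> \<open>\<open>transfer_duality\<close> takes functions on the whole line, so
      \<open>F\<close> is extended by \<open>0\<close>.\<close>
    define F' where "F' x = F x * indicator J x" for x
    have F' [measurable]: "F' \<in> borel_measurable borel"
      using F unfolding F'_def measurable_cong_sets[OF sets_lam refl]
      by (subst (asm) borel_measurable_restrict_space_iff_ennreal) auto
    have "(\<integral>\<^sup>+x. ennreal p * F (T x) + ennreal (1 - p) * F (L x) \<partial>\<mu>) =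
        ennreal p * (\<integral>\<^sup>+x. F (T x) \<partial>\<mu>) + ennreal (1 - p) * (\<integral>\<^sup>+x. F (L x) \<partial>\<mu>)"
      by (simp add: nn_integral_add nn_integral_cmult)
    also have "(\<integral>\<^sup>+x. F (T x) \<partial>\<mu>) = (\<integral>\<^sup>+x. F' (T x) * ennreal (h x) * indicator J x \<partial>lborel) / ennreal right_end / C"
      by (subst int; measurable?) (auto intro!: arg_cong[where f = "\<lambda>z. z / ennreal right_end / C"] nn_integral_cong
        simp: F'_def greedy_map_mem_J split: split_indicator)
    also have "(\<integral>\<^sup>+x. F (L x) \<partial>\<mu>) = (\<integral>\<^sup>+x. F' (L x) * ennreal (h x) * indicator J x \<partial>lborel) / ennreal right_end / C"
      by (subst int; measurable?) (auto intro!: arg_cong[where f = "\<lambda>z. z / ennreal right_end / C"] nn_integral_cong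
        simp: F'_def lazy_map_mem_J split: split_indicator)
    also have "ennreal p * ((\<integral>\<^sup>+x. F' (T x) * ennreal (h x) * indicator J x \<partial>lborel) / ennreal right_end / C) +
        ennreal (1 - p) * ((\<integral>\<^sup>+x. F' (L x) * ennreal (h x) * indicator J x \<partial>lborel) / ennreal right_end / C) =
      (\<integral>\<^sup>+y. F' y * ennreal (transfer h y) * indicator J y \<partial>lborel) / ennreal right_end / C"
      unfolding transfer_duality[OF F' h h0(1), symmetric]
      by (simp add: ennreal_times_divide add_divide_distrib_ennreal)
    also have "(\<integral>\<^sup>+y. F' y * ennreal (transfer h y) * indicator J y \<partial>lborel) =
      (\<integral>\<^sup>+y. F y * ennreal (h y) * indicator J y \<partial>lborel)"
      by (intro nn_integral_cong_AE) (use AE_lborel_singleton[of "right_end - 1"] in \<open>eventually_elim, auto simp: F'_def tr split: split_indicator\<close>)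
    also have "\<dots> / ennreal right_end / C = (\<integral>\<^sup>+x. F x \<partial>\<mu>)" by (rule int[symmetric]) simp
    finally show "(\<integral>\<^sup>+x. ennreal p * F (T x) + ennreal (1 - p) * F (L x) \<partial>\<mu>) = (\<integral>\<^sup>+x. F x \<partial>\<mu>)" .
  qed
qed


section \<open>Constancy of subharmonic functions\<close>

lemma AE_branch:
  assumes "AE x in lborel. P x"
  shows "AE y in lborel. P (branch d y)"
proof -
  obtain N where N: "{x. \<not> P x} \<subseteq> N" "N \<in> null_sets lborel"
    using assms by (auto simp: eventually_ae_filter)
  have "AE y in lborel. of_int d / \<beta> + 1 / \<beta> * y \<notin> N"
    using N(2) beta by (intro AE_borel_affine) (auto intro: AE_not_in)
  thus ?thesis
  proof eventually_elim
    case (elim y)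
    hence "branch d y \<notin> N" by (simp add: branch_def add_divide_distrib add.commute)
    thus ?case using N(1) by blast
  qed
qed

text \<open>The primitive \<open>G\<close> of \<open>k\<close> satisfies \<open>G ((y + d) / \<beta>) = G (d / \<beta>) + G y / \<beta>\<close>. As \<open>a\<close> is fixed by the last
  branch and \<open>G a = 0\<close>, this forces \<open>G 1 = 0\<close>, hence \<open>G (d / \<beta>) = 0\<close>, and \<open>G\<close> is contracted to \<open>0\<close>.\<close>

lemma branch_invariant_cumulative_zero:
  fixes k :: "real \<Rightarrow> real"
  assumes k [measurable]: "integrable lborel k" and outside: "\<And>x. x \<notin> J \<Longrightarrow> k x = 0"
    and mean_zero: "(\<integral>x. k x \<partial>lborel) = 0"
    and inv: "\<And>d. d \<in> {0..top_digit} \<Longrightarrow> AE y in lborel. y \<in> J \<longrightarrow> k (branch d y) = k y"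
  shows "(\<integral>z. indicator {..x} z * k z \<partial>lborel) = 0"
proof -
  define G where "G x = (\<integral>z. indicator {..x} z * k z \<partial>lborel)" for x
  have int: "integrable lborel (\<lambda>z. indicator A z * k z)" if "A \<in> sets borel" for A
    using integrable_mult_indicator[of A lborel k] k that by simp
  have diff: "G y - G x = (\<integral>z. indicator {x<..y} z * k z \<partial>lborel)" if "x \<le> y" for x y
  proof -
    have "G y - G x = (\<integral>z. indicator {..y} z * k z - indicator {..x} z * k z \<partial>lborel)"
      unfolding G_def by (intro Bochner_Integration.integral_diff[symmetric] int) auto
    also have "\<dots> = (\<integral>z. indicator {x<..y} z * k z \<partial>lborel)"
      using that by (intro Bochner_Integration.integral_cong) (auto simp: indicator_def)
    finally show ?thesis .
  qed
  have G0: "G x = 0" if "x \<le> 0" for x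
  proof -
    have "G x = (\<integral>z. 0 \<partial>(lborel :: real measure))"
      unfolding G_def
    proof (rule Bochner_Integration.integral_cong_AE)
      show "AE z in lborel. indicator {..x} z * k z = 0"
        using AE_lborel_singleton[of 0]
        by eventually_elim (use that outside in \<open>auto simp: mem_J_iff indicator_def\<close>)
    qed (use k in auto)
    thus ?thesis by simp
  qed
  have G1: "G x = 0" if "right_end \<le> x" for x
  proof -
    have "G x = (\<integral>z. k z \<partial>lborel)"
      unfolding G_def using that outside
      by (intro Bochner_Integration.integral_cong) (auto simp: mem_J_iff indicator_def)
    thus ?thesis by (simp add: mean_zero)
  qed
  have branch: "G (branch d y) = G (branch d 0) + G y / \<beta>" if y: "y \<in> J" and d: "d \<in> {0..top_digit}" for d y
  proof -
    have le: "branch d 0 \<le> branch d y" using y beta by (simp add: branch_def divide_right_mono mem_J_iff)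
    have br: "of_int d / \<beta> + 1 / \<beta> * w = branch d w" for w
      by (simp add: branch_def add_divide_distrib)
    have "G (branch d y) - G (branch d 0) = (\<integral>z. indicator {branch d 0<..branch d y} z * k z \<partial>lborel)"
      by (rule diff[OF le])
    also have "\<dots> = \<bar>1 / \<beta>\<bar> *\<^sub>R (\<integral>w. indicator {branch d 0<..branch d y} (of_int d / \<beta> + 1 / \<beta> * w) *
        k (of_int d / \<beta> + 1 / \<beta> * w) \<partial>lborel)"
      using beta by (intro lborel_integral_real_affine) auto
    also have "\<dots> = (\<integral>w. indicator {branch d 0<..branch d y} (branch d w) * k (branch d w) \<partial>lborel) / \<beta>"
      unfolding br using beta by simp
    also have "(\<integral>w. indicator {branch d 0<..branch d y} (branch d w) * k (branch d w) \<partial>lborel) =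
        (\<integral>w. indicator {0<..y} w * k w \<partial>lborel)"
    proof (rule Bochner_Integration.integral_cong_AE)
      show "AE w in lborel. indicator {branch d 0<..branch d y} (branch d w) * k (branch d w) =
          indicator {0<..y} w * k w"
        using inv[OF d]
      proof eventually_elim
        case (elim w)
        have "branch d 0 < branch d w \<longleftrightarrow> 0 < w" "branch d w \<le> branch d y \<longleftrightarrow> w \<le> y"
          using beta by (auto simp: branch_def divide_less_cancel divide_le_cancel)
        thus ?case using elim y by (auto simp: indicator_def mem_J_iff)
      qed
    qed (use k in measurable)
    also have "\<dots> = G y" using diff[of 0 y] G0[of 0] y by (simp add: mem_J_iff)
    finally show ?thesis by simp
  qed
  have J: "1 \<in> J" "right_end \<in> J" using right_end_gt_1 by (auto simp: mem_J_iff)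
  \<comment> \<open>Consecutive branches abut, \<open>branch (n + 1) 0 = branch n 1\<close>, so
    \<open>G\<close> grows by \<open>G 1 / \<beta>\<close> from each node to the next.\<close>
  have node: "of_nat n \<le> top_digit \<Longrightarrow> G (branch (of_nat n) 0) = of_nat n * (G 1 / \<beta>)" for n
  proof (induction n)
    case 0
    show ?case by (simp add: branch_def G0)
  next
    case (Suc n)
    have "branch (of_nat (Suc n)) 0 = branch (of_nat n) 1" by (simp add: branch_def)
    thus ?case using branch[OF J(1), of "of_nat n"] Suc by (simp add: algebra_simps add_divide_distrib)
  qed
  have "branch top_digit right_end = right_end"
    using beta beta_right_end by (simp add: branch_def field_simps)
  hence "G (branch top_digit 0) = 0"
    using branch[OF J(2), of top_digit] top_digit_ge_1 G1[of right_end] by simp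
  hence "G 1 = 0"
    using node[of "nat top_digit"] top_digit_ge_1 beta by simp
  hence nodes: "G (branch d 0) = 0" if "d \<in> {0..top_digit}" for d
    using node[of "nat d"] that by simp
  have bound: "\<bar>G x\<bar> \<le> (\<integral>z. \<bar>k z\<bar> \<partial>lborel)" for x
  proof -
    have "\<bar>G x\<bar> \<le> (\<integral>z. \<bar>indicator {..x} z * k z\<bar> \<partial>lborel)"
      unfolding G_def by (rule integral_abs_bound)
    also have "\<dots> \<le> (\<integral>z. \<bar>k z\<bar> \<partial>lborel)"
      using k by (intro integral_mono integrable_abs int) (auto simp: indicator_def)
    finally show ?thesis .
  qed
  define B where "B = (\<integral>z. \<bar>k z\<bar> \<partial>lborel)"
  have contract: "\<bar>G x\<bar> \<le> B / \<beta> ^ n" if "x \<in> J" for x n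
    using that
  proof (induction n arbitrary: x)
    case (Suc n)
    obtain d where d: "d \<in> {0..top_digit}" "T x = \<beta> * x - of_int d" "T x \<in> J"
      using Suc.prems by (rule greedy_digitE)
    have "G x = G (T x) / \<beta>" using branch[OF d(3,1)] nodes[OF d(1)] d(2) by (simp add: branch_beta)
    moreover have "\<bar>G (T x)\<bar> / \<beta> \<le> B / \<beta> ^ n / \<beta>"
      using Suc.IH[OF d(3)] beta by (intro divide_right_mono) auto
    ultimately have "\<bar>G x\<bar> \<le> B / \<beta> ^ n / \<beta>" using beta by (simp add: abs_divide)
    thus ?case by (simp add: mult.commute)
  qed (simp add: bound B_def)
  have "G x = 0" if "x \<in> J" for x
  proof -
    have "(\<lambda>n. B / \<beta> ^ n) \<longlonglongrightarrow> 0"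
      using summable_LIMSEQ_zero[OF sums_summable[OF inverse_power_sums]] .
    hence "\<bar>G x\<bar> \<le> 0" using contract[OF that] by (intro LIMSEQ_le_const) auto
    thus ?thesis by simp
  qed
  thus ?thesis
    using G0[of x] G1[of x] unfolding G_def[symmetric] mem_J_iff
    by (cases "x \<le> 0"; cases "right_end \<le> x") auto
qed

text \<open>Both functions are densities of finite Borel measures with the same distribution
  function, and densities are unique almost everywhere.\<close>

lemma AE_eq_of_cumulative_eq:
  fixes f g :: "real \<Rightarrow> real"
  assumes [measurable]: "integrable lborel f" "integrable lborel g" and nn: "\<And>x. 0 \<le> f x" "\<And>x. 0 \<le> g x"
    and eq: "\<And>x. (\<integral>z. indicator {..x} z * f z \<partial>lborel) = (\<integral>z. indicator {..x} z * g z \<partial>lborel)"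
  shows "AE x in lborel. f x = g x"
proof -
  have cdf: "cdf (density lborel h) x = (\<integral>z. indicator {..x} z * h z \<partial>lborel) \<and>
      finite_borel_measure (density lborel h)"
    if [measurable]: "integrable lborel h" and nn: "\<And>x. 0 \<le> h x" for h :: "real \<Rightarrow> real" and x
  proof -
    have int: "integrable lborel (\<lambda>z. indicator {..x} z * h z)"
      using integrable_mult_indicator[of "{..x}" lborel h] that by simp
    have "emeasure (density lborel h) {..x} = (\<integral>\<^sup>+z. ennreal (indicator {..x} z * h z) \<partial>lborel)"
      by (subst emeasure_density) (auto intro!: nn_integral_cong simp: indicator_def)
    also have "\<dots> = ennreal (\<integral>z. indicator {..x} z * h z \<partial>lborel)"
      using nn by (intro nn_integral_eq_integral int) auto
    finally have "cdf (density lborel h) x = (\<integral>z. indicator {..x} z * h z \<partial>lborel)"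
      using nn by (simp add: cdf_def measure_def integral_nonneg_AE)
    moreover have "emeasure (density lborel h) UNIV = ennreal (\<integral>z. h z \<partial>lborel)"
      using that by (subst emeasure_density) (auto simp: nn_integral_eq_integral)
    hence "finite_borel_measure (density lborel h)"
      by (intro finite_borel_measure.intro finite_borel_measure_axioms.intro finite_measureI) auto
    ultimately show ?thesis by blast
  qed
  have "density lborel f = density lborel g"
    by (rule cdf_unique') (use cdf[OF assms(1) nn(1)] cdf[OF assms(2) nn(2)] eq in auto)
  hence "AE x in lborel. ennreal (f x) = ennreal (g x)"
    by (intro sigma_finite_measure.density_unique) (auto simp: lborel.sigma_finite_measure_axioms)
  thus ?thesis by eventually_elim (simp add: nn)
qed

text \<open>Subtracting the mean \<open>c\<close> over \<open>J\<close> gives a function with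
  vanishing primitive. As \<open>g\<close> and \<open>c\<close> are nonnegative on \<open>J\<close>,
  they can be compared there as densities.\<close>

lemma branch_invariant_const:
  fixes g :: "real \<Rightarrow> real"
  assumes [measurable]: "g \<in> borel_measurable borel" and g: "\<And>x. x \<in> J \<Longrightarrow> 0 \<le> g x \<and> g x \<le> 1"
    and inv: "\<And>d. d \<in> {0..top_digit} \<Longrightarrow> AE y in lborel. y \<in> J \<longrightarrow> g (branch d y) = g y"
  obtains c where "AE x in lborel. x \<in> J \<longrightarrow> g x = c"
proof -
  have iJ: "integrable lborel (indicator J :: real \<Rightarrow> real)"
    by (simp add: integrable_indicator_iff emeasure_lborel_J)
  have int: "integrable lborel (\<lambda>x. indicator J x * g x)"
    by (rule Bochner_Integration.integrable_bound[OF iJ]) (use g in \<open>auto simp: indicator_def\<close>)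
  define c where "c = (\<integral>x. indicator J x * g x \<partial>lborel) / right_end"
  have meas: "measure lborel J = right_end"
    using right_end_gt_1 by (simp add: measure_def emeasure_lborel_J)
  have c: "0 \<le> c"
    unfolding c_def using right_end_gt_1 g by (intro divide_nonneg_pos integral_nonneg_AE) (auto simp: indicator_def)
  define k where "k x = indicator J x * g x - indicator J x * c" for x
  have ik: "integrable lborel k" unfolding k_def using int iJ by simp
  have "(\<integral>x. k x \<partial>lborel) = 0"
    unfolding k_def using int iJ right_end_gt_1 meas by (simp add: c_def)
  hence "(\<integral>z. indicator {..x} z * k z \<partial>lborel) = 0" for x
  proof (intro branch_invariant_cumulative_zero ik)
    fix d assume d: "d \<in> {0..top_digit}"
    show "AE y in lborel. y \<in> J \<longrightarrow> k (branch d y) = k y"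
      using inv[OF d] by eventually_elim (auto simp: k_def branch_mem_J[OF _ d])
  qed (auto simp: k_def)
  moreover have "(\<integral>z. indicator {..x} z * k z \<partial>lborel) =
      (\<integral>z. indicator {..x} z * (indicator J z * g z) \<partial>lborel) - (\<integral>z. indicator {..x} z * (indicator J z * c) \<partial>lborel)" for x
    unfolding k_def right_diff_distrib
    using integrable_mult_indicator[OF _ int, of "{..x}"] integrable_mult_indicator[OF _ integrable_mult_left[OF iJ, of c], of "{..x}"]
    by (intro Bochner_Integration.integral_diff) auto
  ultimately have "AE x in lborel. indicator J x * g x = indicator J x * c"
    using g c by (intro AE_eq_of_cumulative_eq int integrable_mult_left[OF iJ]) (auto simp: indicator_def)
  hence "AE x in lborel. x \<in> J \<longrightarrow> g x = c" by eventually_elim (auto simp: indicator_def)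
  thus ?thesis by (rule that)
qed

end

section \<open>The Markov operator of a stationary measure\<close>

locale stationary_measure = random_beta_system + prob_space \<mu> for \<mu> :: "real measure" +
  assumes sets_\<mu>: "sets \<mu> = sets lam" and null_sets_\<mu>: "null_sets \<mu> = null_sets lam"
    and stationary: "\<And>F. F \<in> borel_measurable lam \<Longrightarrow>
      (\<integral>\<^sup>+x. ennreal p * F (T x) + ennreal (1 - p) * F (L x) \<partial>\<mu>) = (\<integral>\<^sup>+x. F x \<partial>\<mu>)"
begin

lemma space_\<mu>: "space \<mu> = J"
  using sets_eq_imp_space_eq[OF sets_\<mu>] by simp

lemma maps_measurable_\<mu> [measurable]: "T \<in> measurable \<mu> \<mu>" "L \<in> measurable \<mu> \<mu>"
  using maps_measurable by (simp_all cong: measurable_cong_sets add: sets_\<mu> sets_lam)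

lemma AE_\<mu>_iff: "(AE x in \<mu>. P x) \<longleftrightarrow> (AE x in lborel. x \<in> J \<longrightarrow> P x)"
proof -
  have "(AE x in \<mu>. P x) \<longleftrightarrow> (AE x in lam. P x)"
    unfolding eventually_ae_filter null_sets_\<mu> space_\<mu> by simp
  thus ?thesis by (simp only: AE_lam_iff)
qed

text \<open>The operator called \<open>Q\<close> in the overview.\<close>

definition koopman :: "(real \<Rightarrow> real) \<Rightarrow> real \<Rightarrow> real" where
  "koopman g x = p * g (T x) + (1 - p) * g (L x)"

lemma koopman_measurable [measurable (raw)]:
  "g \<in> borel_measurable \<mu> \<Longrightarrow> koopman g \<in> borel_measurable \<mu>"
  using measurable_compose[OF maps_measurable_\<mu>(1), of g borel]
    measurable_compose[OF maps_measurable_\<mu>(2), of g borel]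
  unfolding koopman_def by simp

lemma koopman_bounds:
  assumes "\<And>x. x \<in> J \<Longrightarrow> 0 \<le> g x \<and> g x \<le> 1" "x \<in> J"
  shows "0 \<le> koopman g x" "koopman g x \<le> 1"
  unfolding koopman_def
  using convex_bounds[of 0 "g (T x)" 1 "g (L x)"] assms greedy_map_mem_J lazy_map_mem_J by auto

lemma bounded_integrable:
  assumes "g \<in> borel_measurable \<mu>" "\<And>x. x \<in> J \<Longrightarrow> 0 \<le> g x \<and> g x \<le> 1"
  shows "integrable \<mu> (g :: real \<Rightarrow> real)"
  by (rule integrable_const_bound[of _ 1]) (use assms in \<open>auto simp: space_\<mu>\<close>)

lemma integral_koopman:
  assumes g [measurable]: "g \<in> borel_measurable \<mu>" and g01: "\<And>x. x \<in> J \<Longrightarrow> 0 \<le> g x \<and> g x \<le> 1"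
  shows "(\<integral>x. koopman g x \<partial>\<mu>) = (\<integral>x. g x \<partial>\<mu>)"
proof -
  have i: "integrable \<mu> g" "integrable \<mu> (koopman g)"
    using koopman_bounds[OF g01] by (auto intro!: bounded_integrable g01 koopman_measurable g)
  have "ennreal (\<integral>x. koopman g x \<partial>\<mu>) = (\<integral>\<^sup>+x. ennreal (koopman g x) \<partial>\<mu>)"
    using i koopman_bounds[OF g01] by (intro nn_integral_eq_integral[symmetric]) (auto simp: space_\<mu>)
  also have "\<dots> = (\<integral>\<^sup>+x. ennreal p * ennreal (g (T x)) + ennreal (1 - p) * ennreal (g (L x)) \<partial>\<mu>)"
    using p g01 greedy_map_mem_J lazy_map_mem_J
    by (intro nn_integral_cong) (simp add: koopman_def space_\<mu> ennreal_mult ennreal_plus)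
  also have "\<dots> = (\<integral>\<^sup>+x. ennreal (g x) \<partial>\<mu>)"
    using g by (intro stationary) (simp cong: measurable_cong_sets add: sets_\<mu>)
  also have "\<dots> = ennreal (\<integral>x. g x \<partial>\<mu>)"
    using i g01 by (intro nn_integral_eq_integral) (auto simp: space_\<mu>)
  finally show ?thesis
    using g01 koopman_bounds[OF g01] by (subst (asm) ennreal_inj) (auto intro!: integral_nonneg_AE simp: space_\<mu>)
qed

text \<open>Stationarity is applied to the indicator of a null set. Since \<open>p\<close> and
  \<open>1 - p\<close> are both positive, its preimages under \<open>T\<close> and under
  \<open>L\<close> are null.\<close>

lemma AE_maps:
  assumes "AE x in \<mu>. P x"
  shows "AE x in \<mu>. P (T x) \<and> P (L x)"
proof -
  obtain N where N: "N \<in> null_sets \<mu>" "{x \<in> J. \<not> P x} \<subseteq> N"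
    using assms by (auto simp: eventually_ae_filter space_\<mu>)
  have Nm [measurable]: "N \<in> sets \<mu>" using N by auto
  have "(\<integral>\<^sup>+x. ennreal p * indicator N (T x) + ennreal (1 - p) * indicator N (L x) \<partial>\<mu>) = (\<integral>\<^sup>+x. indicator N x \<partial>\<mu>)"
    using Nm sets_\<mu> by (intro stationary) auto
  also have "\<dots> = 0" using N by (simp add: null_setsD1)
  finally have "AE x in \<mu>. ennreal p * indicator N (T x) + ennreal (1 - p) * indicator N (L x) = 0"
    by (subst (asm) nn_integral_0_iff_AE) auto
  thus ?thesis
    using AE_space
  proof eventually_elim
    case (elim x)
    hence "T x \<notin> N" "L x \<notin> N" using p by (auto simp: indicator_def split: if_splits)
    thus ?case using N(2) greedy_map_mem_J lazy_map_mem_J elim(2) by (auto simp: space_\<mu>)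
  qed
qed

text \<open>At the point \<open>branch d y\<close> one of \<open>T\<close> and \<open>L\<close>
  returns \<open>y\<close>, so invariance under both maps gives the branch invariance required by
  \<open>branch_invariant_const\<close>.\<close>

lemma maps_invariant_const:
  assumes g [measurable]: "g \<in> borel_measurable \<mu>" and g01: "\<And>x. x \<in> J \<Longrightarrow> 0 \<le> g x \<and> g x \<le> 1"
    and inv: "AE x in \<mu>. g (T x) = g x \<and> g (L x) = g x"
  obtains c :: real where "AE x in \<mu>. g x = c"
proof -
  define g' where "g' x = indicator J x * g x" for x
  have g': "g' x = g x" if "x \<in> J" for x using that by (simp add: g'_def)
  have "g \<in> borel_measurable (restrict_space borel J)"
    using g by (simp cong: measurable_cong_sets add: sets_\<mu> sets_lam)
  hence m: "g' \<in> borel_measurable borel"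
    unfolding g'_def by (subst (asm) borel_measurable_restrict_space_iff) auto
  have TL: "AE x in lborel. x \<in> J \<longrightarrow> g (T x) = g x \<and> g (L x) = g x"
    using inv unfolding AE_\<mu>_iff .
  have br: "AE y in lborel. y \<in> J \<longrightarrow> g' (branch d y) = g' y" if d: "d \<in> {0..top_digit}" for d
    using AE_branch[OF TL, of d]
  proof eventually_elim
    case (elim y)
    show ?case
    proof
      assume y: "y \<in> J"
      note b = branch_mem_J[OF y d]
      have "g (T (branch d y)) = g (branch d y)" "g (L (branch d y)) = g (branch d y)"
        using elim b by auto
      thus "g' (branch d y) = g' y"
        using greedy_or_lazy_map_branch[OF y d] by (auto simp: g' b y)
    qed
  qed
  from branch_invariant_const[OF m _ br] g01 g'
  obtain c where "AE x in lborel. x \<in> J \<longrightarrow> g' x = c" by auto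
  hence "AE x in \<mu>. g x = c" unfolding AE_\<mu>_iff by eventually_elim (simp add: g')
  thus ?thesis by (rule that)
qed

text \<open>Jensen's inequality for the square, \<open>Q (g\<^sup>2) - (Q g)\<^sup>2 = p (1 - p) (g \<circ> T - g \<circ> L)\<^sup>2\<close>, integrates to an
  equality for a subharmonic \<open>g\<close>.\<close>

lemma subharmonic_const:
  assumes g [measurable]: "g \<in> borel_measurable \<mu>" and g01: "\<And>x. x \<in> J \<Longrightarrow> 0 \<le> g x \<and> g x \<le> 1"
    and sub: "AE x in \<mu>. g x \<le> koopman g x"
  obtains c :: real where "AE x in \<mu>. g x = c"
proof -
  let ?sq = "\<lambda>x. g x ^ 2" and ?D = "\<lambda>x. p * (1 - p) * (g (T x) - g (L x)) ^ 2"
  have sq01: "0 \<le> g x ^ 2 \<and> g x ^ 2 \<le> 1" if "x \<in> J" for x using g01[OF that] by (simp add: power_le_one)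
  have kk: "0 \<le> koopman g x \<and> koopman g x \<le> 1" if "x \<in> J" for x using koopman_bounds[OF g01 that] by simp
  have ksq: "0 \<le> koopman ?sq x \<and> koopman ?sq x \<le> 1" if "x \<in> J" for x using koopman_bounds[OF sq01 that] by simp
  have i: "integrable \<mu> g" "integrable \<mu> ?sq" "integrable \<mu> (koopman ?sq)" "integrable \<mu> (koopman g)"
    by (auto intro!: bounded_integrable g01 sq01 kk ksq)
  have var: "koopman ?sq x = koopman g x ^ 2 + ?D x" for x
    by (simp add: koopman_def power2_eq_square algebra_simps)
  \<comment> \<open>The inequality \<open>g x \<le> koopman g x\<close> may be squared because
    \<open>g\<close> is nonnegative.\<close>
  have le: "AE x in \<mu>. ?sq x \<le> koopman ?sq x - ?D x"
    using sub AE_space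
  proof eventually_elim
    case (elim x)
    thus ?case unfolding var using g01[of x] by (simp add: space_\<mu> power_mono)
  qed
  have D0: "0 \<le> ?D x" for x using p by simp
  have "AE x in \<mu>. koopman ?sq x - ?sq x = 0"
  proof (rule integral_nonneg_eq_0_iff_AE[THEN iffD1])
    show "AE x in \<mu>. 0 \<le> koopman ?sq x - ?sq x" using le
    proof eventually_elim
      case (elim x)
      thus ?case using D0[of x] by linarith
    qed
    show "(\<integral>x. koopman ?sq x - ?sq x \<partial>\<mu>) = 0"
      using i integral_koopman[of ?sq] sq01 by simp
  qed (use i in simp)
  hence TL: "AE x in \<mu>. g (T x) = g (L x)"
    using le
  proof eventually_elim
    case (elim x)
    hence "?D x \<le> 0" by linarith
    hence "?D x = 0" using D0[of x] by linarith
    thus ?case using p by simp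
  qed
  have "AE x in \<mu>. koopman g x - g x = 0"
  proof (rule integral_nonneg_eq_0_iff_AE[THEN iffD1])
    show "AE x in \<mu>. 0 \<le> koopman g x - g x" using sub by eventually_elim simp
    show "(\<integral>x. koopman g x - g x \<partial>\<mu>) = 0" using i integral_koopman[of g] g01 by simp
  qed (use i in simp)
  hence "AE x in \<mu>. g (T x) = g x \<and> g (L x) = g x"
    using TL by eventually_elim (simp add: koopman_def algebra_simps)
  from maps_invariant_const[OF g g01 this] that show ?thesis by blast
qed

end

section \<open>The skew product over the Bernoulli shift\<close>

text \<open>Recursion on the list peels off the first symbol, the one that \<open>K\<close>
  consumes. Sets of symbols instead of single ones allow unconstrained positions.\<close>

primrec cylinder :: "bool set list \<Rightarrow> (nat \<Rightarrow> bool) set" where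
  "cylinder [] = UNIV"
| "cylinder (B # Bs) = {\<omega>. \<omega> 0 \<in> B \<and> shift \<omega> \<in> cylinder Bs}"

lemma mem_cylinder_iff: "\<omega> \<in> cylinder Bs \<longleftrightarrow> (\<forall>i<length Bs. \<omega> i \<in> Bs ! i)"
  by (induction Bs arbitrary: \<omega>) (auto simp: shift_def nth_Cons less_Suc_eq_0_disj split: nat.splits)

lemma sets_bernoulli: "sets (bernoulli_measure p) = sets (\<Pi>\<^sub>M i\<in>UNIV. count_space UNIV)"
  unfolding bernoulli_measure_def by (intro sets_PiM_cong) auto

lemma space_bernoulli [simp]: "space (bernoulli_measure p) = UNIV"
  by (simp add: bernoulli_measure_def space_PiM)

lemma prob_space_bernoulli: "prob_space (bernoulli_measure p)"
  unfolding bernoulli_measure_def by (intro prob_space_PiM prob_space_measure_pmf)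

lemma coordinate_measurable [measurable]:
  "(\<lambda>\<omega>. \<omega> i) \<in> measurable (bernoulli_measure p) (count_space UNIV)"
  by (subst measurable_cong_sets[OF sets_bernoulli refl]) (rule measurable_component_singleton, simp)

lemma shift_measurable [measurable]: "shift \<in> measurable (bernoulli_measure p) (bernoulli_measure p)"
proof (subst measurable_cong_sets[OF refl sets_bernoulli])
  show "shift \<in> measurable (bernoulli_measure p) (\<Pi>\<^sub>M i\<in>UNIV. count_space UNIV)"
    unfolding shift_def by (rule measurable_PiM_single') auto
qed

lemma case_nat_bernoulli_measurable [measurable]:
  "case_nat s \<in> measurable (bernoulli_measure p) (bernoulli_measure p)"
  unfolding bernoulli_measure_def by (intro measurable_case_nat') auto

lemma cylinder_measurable [measurable]: "cylinder Bs \<in> sets (bernoulli_measure p)"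
proof -
  have "cylinder Bs = {\<omega> \<in> space (bernoulli_measure p). \<forall>i<length Bs. \<omega> i \<in> Bs ! i}"
    by (auto simp: mem_cylinder_iff)
  also have "\<dots> \<in> sets (bernoulli_measure p)" by measurable
  finally show ?thesis .
qed

text \<open>Conditioning on the first symbol: \<open>case_nat\<close> prepends an independent symbol
  and carries the product of \<open>bernoulli_pmf p\<close> and the Bernoulli measure to the
  Bernoulli measure.\<close>

lemma measure_bernoulli_step:
  assumes p: "0 \<le> p" "p \<le> 1" and E [measurable]: "E \<in> sets (bernoulli_measure p)"
  shows "measure (bernoulli_measure p) E =
    p * measure (bernoulli_measure p) {\<omega>. case_nat True \<omega> \<in> E} +
    (1 - p) * measure (bernoulli_measure p) {\<omega>. case_nat False \<omega> \<in> E}"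
proof -
  interpret sequence_space "measure_pmf (bernoulli_pmf p)" by unfold_locales
  interpret m: prob_space "bernoulli_measure p" by (rule prob_space_bernoulli)
  let ?m = "bernoulli_measure p"
  have S: "?m = S" by (simp add: bernoulli_measure_def)
  have pre [measurable]: "{\<omega>. case_nat s \<omega> \<in> E} \<in> sets ?m" for s
    using measurable_sets[OF case_nat_bernoulli_measurable E, of s] by (simp add: vimage_def)
  have [measurable]: "(\<lambda>(s, \<omega>). case_nat s \<omega>) \<in> measurable (measure_pmf (bernoulli_pmf p) \<Otimes>\<^sub>M ?m) ?m"
    unfolding bernoulli_measure_def by measurable
  have "emeasure ?m E = emeasure (distr (measure_pmf (bernoulli_pmf p) \<Otimes>\<^sub>M ?m) ?m (\<lambda>(s, \<omega>). case_nat s \<omega>)) E"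
    using PiM_iter by (simp add: S)
  also have "\<dots> = emeasure (measure_pmf (bernoulli_pmf p) \<Otimes>\<^sub>M ?m) ((\<lambda>(s, \<omega>). case_nat s \<omega>) -` E \<inter> space (measure_pmf (bernoulli_pmf p) \<Otimes>\<^sub>M ?m))"
    by (rule emeasure_distr) measurable
  also have "\<dots> = (\<integral>\<^sup>+s. emeasure ?m (Pair s -` ((\<lambda>(s, \<omega>). case_nat s \<omega>) -` E \<inter> space (measure_pmf (bernoulli_pmf p) \<Otimes>\<^sub>M ?m))) \<partial>measure_pmf (bernoulli_pmf p))"
    by (rule m.emeasure_pair_measure_alt) measurable
  also have "\<dots> = (\<integral>\<^sup>+s. emeasure ?m {\<omega>. case_nat s \<omega> \<in> E} \<partial>measure_pmf (bernoulli_pmf p))"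
    by (intro nn_integral_cong arg_cong[where f = "emeasure ?m"]) (auto simp: space_pair_measure)
  also have "\<dots> = emeasure ?m {\<omega>. case_nat True \<omega> \<in> E} * ennreal p + emeasure ?m {\<omega>. case_nat False \<omega> \<in> E} * ennreal (1 - p)"
    using p by simp
  also have "\<dots> = ennreal (p * measure ?m {\<omega>. case_nat True \<omega> \<in> E} + (1 - p) * measure ?m {\<omega>. case_nat False \<omega> \<in> E})"
    using p by (simp add: m.emeasure_eq_measure ennreal_mult mult.commute)
  finally show ?thesis using p unfolding m.emeasure_eq_measure by (subst (asm) ennreal_inj) auto
qed

text \<open>A rectangle over finitely many coordinates is a cylinder with \<open>UNIV\<close> in the
  unconstrained positions, and rectangles determine a finite measure.\<close>

lemma bernoulli_measure_eqI:
  assumes sets: "sets P = sets (bernoulli_measure p)" "sets Q = sets (bernoulli_measure p)"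
    and fin: "finite_measure P" and eq: "\<And>Bs. emeasure P (cylinder Bs) = emeasure Q (cylinder Bs)"
  shows "P = Q"
proof (rule measure_eqI_PiM_infinite[where I = "UNIV :: nat set" and M = "\<lambda>_. measure_pmf (bernoulli_pmf p)"])
  fix A :: "nat \<Rightarrow> bool set" and J :: "nat set" assume J: "finite J"
  obtain n where n: "J \<subseteq> {..<n}" using finite_nat_bounded[OF J] by blast
  have "prod_emb UNIV (\<lambda>_. measure_pmf (bernoulli_pmf p)) J (Pi\<^sub>E J A) =
      cylinder (map (\<lambda>j. if j \<in> J then A j else UNIV) [0..<n])"
  proof (intro set_eqI)
    fix \<omega> :: "nat \<Rightarrow> bool"
    have "\<omega> \<in> cylinder (map (\<lambda>j. if j \<in> J then A j else UNIV) [0..<n]) \<longleftrightarrow> (\<forall>i<n. i \<in> J \<longrightarrow> \<omega> i \<in> A i)"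
      by (auto simp: mem_cylinder_iff)
    thus "\<omega> \<in> prod_emb UNIV (\<lambda>_. measure_pmf (bernoulli_pmf p)) J (Pi\<^sub>E J A) \<longleftrightarrow>
        \<omega> \<in> cylinder (map (\<lambda>j. if j \<in> J then A j else UNIV) [0..<n])"
      using n by (auto simp: prod_emb_def PiE_iff)
  qed
  thus "emeasure P (prod_emb UNIV (\<lambda>_. measure_pmf (bernoulli_pmf p)) J (Pi\<^sub>E J A)) =
      emeasure Q (prod_emb UNIV (\<lambda>_. measure_pmf (bernoulli_pmf p)) J (Pi\<^sub>E J A))"
    using eq by simp
qed (use sets fin in \<open>auto simp: bernoulli_measure_def\<close>)

section \<open>Fibres of the random map and invariance of the product measure\<close>

context stationary_measure begin

abbreviation m :: "(nat \<Rightarrow> bool) measure" where "m \<equiv> bernoulli_measure p"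

abbreviation \<nu> :: "((nat \<Rightarrow> bool) \<times> real) measure" where "\<nu> \<equiv> m \<Otimes>\<^sub>M \<mu>"

sublocale m: prob_space m by (rule prob_space_bernoulli)

sublocale prod: pair_prob_space m \<mu> ..

definition fiber :: "((nat \<Rightarrow> bool) \<times> real) set \<Rightarrow> real \<Rightarrow> (nat \<Rightarrow> bool) set" where
  "fiber A x = {\<omega>. (\<omega>, x) \<in> A}"

lemma fiber_sets [measurable]: "A \<in> sets \<nu> \<Longrightarrow> fiber A x \<in> sets m"
  using sets_Pair2[of A m \<mu> x] by (simp add: fiber_def vimage_def)

lemma switching_sets [measurable]: "switching \<in> sets \<mu>"
proof -
  have "switching = (\<Union>k\<in>{1..top_digit}. switch_region \<beta> k) \<inter> J" by (auto simp: switching_def)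
  moreover have "(\<Union>k\<in>{1..top_digit}. switch_region \<beta> k) \<in> sets borel"
    by (intro sets.finite_UN) (auto simp: switch_region_def)
  ultimately show ?thesis by (auto simp: sets_\<mu> sets_lam sets_restrict_space)
qed

lemma random_map_measurable [measurable]: "K \<in> measurable \<nu> \<nu>"
proof -
  have "(\<lambda>z. if snd z \<in> switching then (shift (fst z), if fst z 0 then T (snd z) else L (snd z))
      else (fst z, T (snd z))) \<in> measurable \<nu> \<nu>"
    by measurable
  moreover have "K z = (if snd z \<in> switching then (shift (fst z), if fst z 0 then T (snd z) else L (snd z))
      else (fst z, T (snd z)))" if "z \<in> space \<nu>" for z
    using that random_map_switching[of "snd z" "fst z"] non_switching(1)[of "snd z" "fst z"]
    by (cases z) (auto simp: space_pair_measure space_\<mu>)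
  ultimately show ?thesis by (subst measurable_cong) auto
qed

text \<open>On the switching set \<open>K\<close> consumes the first symbol, which selects
  \<open>T\<close> or \<open>L\<close>, and the rest of the sequence is again distributed by
  \<open>m\<close>. Elsewhere the two maps agree and the sequence is kept. Integrating out the
  symbols thus turns \<open>K\<close> into \<open>Q\<close>.\<close>

lemma measure_fiber_step:
  assumes A [measurable]: "A \<in> sets \<nu>" and x: "x \<in> J"
  shows "measure m {\<omega>. K (\<omega>, x) \<in> A} = p * measure m (fiber A (T x)) + (1 - p) * measure m (fiber A (L x))"
proof (cases "x \<in> switching")
  case True
  have "{\<omega>. K (\<omega>, x) \<in> A} = fiber (K -` A \<inter> space \<nu>) x"
    using x by (auto simp: fiber_def space_pair_measure space_\<mu>)
  also have "\<dots> \<in> sets m" by measurable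
  finally show ?thesis
    using p by (subst measure_bernoulli_step) (simp_all add: random_map_switching[OF True] shift_def fiber_def)
next
  case False
  thus ?thesis using non_switching[OF x] by (simp add: fiber_def algebra_simps)
qed

lemma measure_fiber_measurable [measurable]:
  assumes "A \<in> sets \<nu>"
  shows "(\<lambda>x. measure m (fiber A x)) \<in> borel_measurable \<mu>"
  using prod.measurable_emeasure_Pair2[OF assms] unfolding measure_def fiber_def vimage_def by measurable

lemma emeasure_\<nu>:
  assumes "A \<in> sets \<nu>"
  shows "emeasure \<nu> A = (\<integral>\<^sup>+x. ennreal (measure m (fiber A x)) \<partial>\<mu>)"
  unfolding prod.emeasure_pair_measure_alt2[OF assms] fiber_def vimage_def m.emeasure_eq_measure ..

text \<open>Integrate \<open>measure_fiber_step\<close> over \<open>\<mu>\<close> and use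
  stationarity.\<close>

lemma invariant_\<nu>: "invariant_measure K \<nu>"
  unfolding invariant_measure_def
proof
  show "distr \<nu> \<nu> K = \<nu>"
  proof (rule measure_eqI)
    fix A assume "A \<in> sets (distr \<nu> \<nu> K)"
    hence A [measurable]: "A \<in> sets \<nu>" by simp
    have "emeasure (distr \<nu> \<nu> K) A = (\<integral>\<^sup>+x. ennreal (measure m (fiber (K -` A \<inter> space \<nu>) x)) \<partial>\<mu>)"
      by (simp add: emeasure_distr emeasure_\<nu>)
    also have "\<dots> = (\<integral>\<^sup>+x. ennreal p * ennreal (measure m (fiber A (T x))) +
        ennreal (1 - p) * ennreal (measure m (fiber A (L x))) \<partial>\<mu>)"
    proof (intro nn_integral_cong)
      fix x assume x: "x \<in> space \<mu>"
      hence "fiber (K -` A \<inter> space \<nu>) x = {\<omega>. K (\<omega>, x) \<in> A}"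
        by (auto simp: fiber_def space_pair_measure)
      thus "ennreal (measure m (fiber (K -` A \<inter> space \<nu>) x)) = ennreal p * ennreal (measure m (fiber A (T x))) +
        ennreal (1 - p) * ennreal (measure m (fiber A (L x)))"
        using x p by (simp add: measure_fiber_step space_\<mu> ennreal_mult)
    qed
    also have "\<dots> = (\<integral>\<^sup>+x. ennreal (measure m (fiber A x)) \<partial>\<mu>)"
      using measure_fiber_measurable[OF A] by (intro stationary) (simp cong: measurable_cong_sets add: sets_\<mu>)
    finally show "emeasure (distr \<nu> \<nu> K) A = emeasure \<nu> A" by (simp add: emeasure_\<nu>)
  qed simp
qed measurable

text \<open>The first switch region is an interval of positive length, because
  \<open>right_end > 1\<close>. This later forces a constant that vanishes on the switching set to
  be \<open>0\<close>.\<close>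

lemma switching_not_null: "\<not> (AE x in \<mu>. x \<notin> switching)"
proof
  assume "AE x in \<mu>. x \<notin> switching"
  hence "AE x in lborel. \<not> (x \<in> J \<and> x \<in> switching)" by (simp add: AE_\<mu>_iff)
  hence "AE x in lborel. x \<notin> {1 / \<beta>..right_end / \<beta>}"
  proof eventually_elim
    case (elim x)
    show ?case
    proof
      assume "x \<in> {1 / \<beta>..right_end / \<beta>}"
      hence b: "1 \<le> \<beta> * x" "\<beta> * x \<le> right_end"
        using beta by (auto simp: divide_le_eq le_divide_eq mult.commute)
      hence "x \<in> switch_region \<beta> 1" by (simp add: mem_switch_region)
      moreover have "x \<in> J" using b top_digit_ge_1 by (simp add: mem_J_beta_iff)
      ultimately show False using elim top_digit_ge_1 by (auto simp: switching_def)
    qed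
  qed
  hence "emeasure lborel {1 / \<beta>..right_end / \<beta>} = 0"
    by (intro null_setsD1) (subst AE_iff_null_sets, simp_all)
  thus False using right_end_gt_1 beta by (simp add: divide_right_mono divide_le_cancel)
qed


section \<open>Ergodicity of the product measure\<close>

lemma fiber_Int_cylinder: "fiber (A \<inter> (cylinder Bs \<times> J)) x = (if x \<in> J then fiber A x \<inter> cylinder Bs else {})"
  by (auto simp: fiber_def)

text \<open>Invariance is asked only modulo null sets, since the level set in
  \<open>acim_unique\<close> is invariant only in this sense.\<close>

lemma ergodic_AE_invariant:
  assumes A [measurable]: "A \<in> sets \<nu>" and inv: "AE z in \<nu>. K z \<in> A \<longleftrightarrow> z \<in> A"
  shows "measure \<nu> A = 0 \<or> measure \<nu> A = 1"
proof -
  have fib [measurable]: "{\<omega>. K (\<omega>, x) \<in> B} \<in> sets m" if "B \<in> sets \<nu>" "x \<in> J" for B x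
  proof -
    have "{\<omega>. K (\<omega>, x) \<in> B} = fiber (K -` B \<inter> space \<nu>) x"
      using that by (auto simp: fiber_def space_pair_measure space_\<mu>)
    thus ?thesis using that by simp
  qed
  have AE: "AE x in \<mu>. AE \<omega> in m. K (\<omega>, x) \<in> A \<longleftrightarrow> (\<omega>, x) \<in> A"
  proof (subst prod.AE_commute[symmetric])
    show "AE \<omega> in m. AE x in \<mu>. K (\<omega>, x) \<in> A \<longleftrightarrow> (\<omega>, x) \<in> A"
      using inv by (rule prod.AE_pair)
  qed simp
  \<comment> \<open>By Fubini almost every fibre of \<open>A\<close> agrees, modulo null sets, with
    that of its preimage. The quantifier over \<open>B\<close> stands inside so that one null set
    serves all cylinders.\<close>
  have swap: "AE x in \<mu>. x \<in> J \<and> (\<forall>B\<in>sets m. measure m (fiber A x \<inter> B) = measure m ({\<omega>. K (\<omega>, x) \<in> A} \<inter> B))"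
    using AE AE_space
  proof eventually_elim
    case (elim x)
    have x: "x \<in> J" using elim by (simp add: space_\<mu>)
    have "measure m (fiber A x \<inter> B) = measure m ({\<omega>. K (\<omega>, x) \<in> A} \<inter> B)" if B: "B \<in> sets m" for B
    proof (rule measure_eq_AE)
      show "AE \<omega> in m. \<omega> \<in> fiber A x \<inter> B \<longleftrightarrow> \<omega> \<in> {\<omega>. K (\<omega>, x) \<in> A} \<inter> B"
        using elim(1) by eventually_elim (auto simp: fiber_def)
    qed (use B fib[OF A x] in auto)
    thus ?case using x by blast
  qed
  define \<Phi> where "\<Phi> x = measure m (fiber A x)" for x
  have \<Phi>_meas: "\<Phi> \<in> borel_measurable \<mu>" unfolding \<Phi>_def by measurable
  have "AE x in \<mu>. \<Phi> x = koopman \<Phi> x"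
    using swap
  proof eventually_elim
    case (elim x)
    hence "\<Phi> x = measure m {\<omega>. K (\<omega>, x) \<in> A}"
      using bspec[of "sets m" _ UNIV] sets.top[of m] unfolding \<Phi>_def by force
    thus ?case using elim measure_fiber_step[OF A] by (simp add: koopman_def \<Phi>_def)
  qed
  hence sub: "AE x in \<mu>. \<Phi> x \<le> koopman \<Phi> x" by eventually_elim simp
  obtain c where c: "AE x in \<mu>. \<Phi> x = c"
    by (rule subharmonic_const[OF \<Phi>_meas _ sub]) (auto simp: \<Phi>_def)
  have c01: "0 \<le> c" "c \<le> 1"
  proof -
    have "AE x in \<mu>. 0 \<le> c \<and> c \<le> 1" using c by eventually_elim (auto simp: \<Phi>_def)
    thus "0 \<le> c" "c \<le> 1" by auto
  qed
  have cyl: "AE x in \<mu>. measure m (fiber A x \<inter> cylinder Bs) = c * measure m (cylinder Bs)" for Bs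
  proof (induction Bs)
    case Nil
    show ?case using c m.prob_space by (simp add: \<Phi>_def)
  next
    case (Cons B Bs)
    define g where "g x = \<bar>measure m (fiber A x \<inter> cylinder (B # Bs)) - c * measure m (cylinder (B # Bs))\<bar>" for x
    have Q: "A \<inter> (cylinder (B # Bs) \<times> space \<mu>) \<in> sets \<nu>" by measurable
    have "(\<lambda>x. measure m (fiber A x \<inter> cylinder (B # Bs))) \<in> borel_measurable \<mu>"
      using measure_fiber_measurable[OF Q] by (rule measurable_cong[THEN iffD1, rotated])
        (simp only: fiber_Int_cylinder space_\<mu> if_True)
    hence gm: "g \<in> borel_measurable \<mu>" unfolding g_def by simp
    have cm: "0 \<le> c * measure m C" "c * measure m C \<le> 1" for C
      using c01 m.prob_le_1[of C] by (auto intro: mult_le_one)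
    have g01: "0 \<le> g x \<and> g x \<le> 1" for x
      unfolding g_def using cm[of "cylinder (B # Bs)"] m.prob_le_1[of "fiber A x \<inter> cylinder (B # Bs)"]
        measure_nonneg[of m "fiber A x \<inter> cylinder (B # Bs)"] by (intro conjI abs_ge_zero) linarith
    \<comment> \<open>On the switching set the first symbol is consumed, and the induction
      hypothesis applies to \<open>Bs\<close> at \<open>T x\<close> and \<open>L x\<close>, which
      are good points by \<open>AE_maps\<close>.\<close>
    have zero: "AE x in \<mu>. x \<in> switching \<longrightarrow> g x = 0"
      using swap AE_maps[OF Cons.IH]
    proof eventually_elim
      case (elim x)
      show ?case
      proof
        assume sw: "x \<in> switching"
        have x: "x \<in> J" using elim by simp
        let ?D = "{\<omega>. K (\<omega>, x) \<in> A} \<inter> cylinder (B # Bs)"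
        have D: "?D \<in> sets m" using fib[OF A x] by measurable
        have "measure m (fiber A x \<inter> cylinder (B # Bs)) = measure m ?D"
          using elim cylinder_measurable by blast
        also have "\<dots> = p * measure m {\<omega>. case_nat True \<omega> \<in> ?D} + (1 - p) * measure m {\<omega>. case_nat False \<omega> \<in> ?D}"
          using p D by (intro measure_bernoulli_step) auto
        also have "{\<omega>. case_nat True \<omega> \<in> ?D} = (if True \<in> B then fiber A (T x) \<inter> cylinder Bs else {})"
          by (auto simp: random_map_switching[OF sw] shift_def fiber_def)
        also have "{\<omega>. case_nat False \<omega> \<in> ?D} = (if False \<in> B then fiber A (L x) \<inter> cylinder Bs else {})"
          by (auto simp: random_map_switching[OF sw] shift_def fiber_def)
        finally have 1: "measure m (fiber A x \<inter> cylinder (B # Bs)) =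
            c * (p * of_bool (True \<in> B) * measure m (cylinder Bs) + (1 - p) * of_bool (False \<in> B) * measure m (cylinder Bs))"
          using elim(2) by (cases "True \<in> B"; cases "False \<in> B") (simp_all add: algebra_simps del: cylinder.simps)
        have "measure m (cylinder (B # Bs)) = p * measure m {\<omega>. case_nat True \<omega> \<in> cylinder (B # Bs)} +
            (1 - p) * measure m {\<omega>. case_nat False \<omega> \<in> cylinder (B # Bs)}"
          using p by (intro measure_bernoulli_step cylinder_measurable) auto
        also have "{\<omega>. case_nat True \<omega> \<in> cylinder (B # Bs)} = (if True \<in> B then cylinder Bs else {})"
          by (auto simp: shift_def)
        also have "{\<omega>. case_nat False \<omega> \<in> cylinder (B # Bs)} = (if False \<in> B then cylinder Bs else {})"
          by (auto simp: shift_def)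
        finally have "measure m (cylinder (B # Bs)) =
            p * of_bool (True \<in> B) * measure m (cylinder Bs) + (1 - p) * of_bool (False \<in> B) * measure m (cylinder Bs)"
          by (cases "True \<in> B"; cases "False \<in> B") (simp_all del: cylinder.simps)
        thus "g x = 0" unfolding g_def 1 by simp
      qed
    qed
    \<comment> \<open>On the switching set the left side is \<open>0\<close>; off it
      \<open>T x = L x\<close> and the sequence is unchanged, so equality holds.\<close>
    have sub: "AE x in \<mu>. g x \<le> koopman g x"
      using zero swap
    proof eventually_elim
      case (elim x)
      show ?case
      proof (cases "x \<in> switching")
        case True
        thus ?thesis using elim koopman_bounds(1)[of g x] g01 by simp
      next
        case False
        have x: "x \<in> J" using elim by simp
        have "{\<omega>. K (\<omega>, x) \<in> A} = fiber A (T x)"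
          using non_switching(1)[OF x False] by (simp add: fiber_def)
        hence "measure m (fiber A x \<inter> cylinder (B # Bs)) = measure m (fiber A (T x) \<inter> cylinder (B # Bs))"
          using elim(2) cylinder_measurable by metis
        hence "g x = g (T x)" unfolding g_def by simp
        thus ?thesis using non_switching(2)[OF x False] by (simp add: koopman_def algebra_simps)
      qed
    qed
    obtain c' where c': "AE x in \<mu>. g x = c'"
      by (rule subharmonic_const[OF gm _ sub]) (use g01 in auto)
    \<comment> \<open>The constant is attained on the switching set, which is not null and where
      \<open>g\<close> vanishes.\<close>
    have "c' = 0"
    proof (rule ccontr)
      assume "c' \<noteq> 0"
      have "AE x in \<mu>. x \<notin> switching"
        using zero c' by eventually_elim (use \<open>c' \<noteq> 0\<close> in auto)
      thus False using switching_not_null by contradiction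
    qed
    thus ?case using c' by (simp add: g_def)
  qed
  \<comment> \<open>Lists of sets of truth values are countable, so the exceptional null sets can be
    united.\<close>
  have "AE x in \<mu>. \<forall>Bs. measure m (fiber A x \<inter> cylinder Bs) = c * measure m (cylinder Bs)"
    using cyl by (simp add: AE_all_countable)
  hence "AE x in \<mu>. c = c * c"
    using c
  proof eventually_elim
    case (elim x)
    have F: "fiber A x \<in> sets m" by measurable
    \<comment> \<open>The restriction of \<open>m\<close> to the fibre agrees with \<open>c\<close>
      times \<open>m\<close> on cylinders, hence everywhere. Evaluation at the fibre itself gives
      \<open>c = c * c\<close>.\<close>
    have "density m (indicator (fiber A x)) = density m (\<lambda>_. ennreal c)"
    proof (rule bernoulli_measure_eqI[of _ p])
      show "finite_measure (density m (indicator (fiber A x)))"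
        using emeasure_restricted[OF F sets.top] by (intro finite_measureI) (simp add: m.emeasure_eq_measure)
      fix Bs
      show "emeasure (density m (indicator (fiber A x))) (cylinder Bs) = emeasure (density m (\<lambda>_. ennreal c)) (cylinder Bs)"
        using elim(1) c01 unfolding emeasure_restricted[OF F cylinder_measurable] emeasure_density_const[OF cylinder_measurable]
        by (simp add: m.emeasure_eq_measure ennreal_mult)
    qed auto
    hence "emeasure (density m (indicator (fiber A x))) (fiber A x) = emeasure (density m (\<lambda>_. ennreal c)) (fiber A x)"
      by simp
    hence "measure m (fiber A x) = c * measure m (fiber A x)"
      using c01 unfolding emeasure_restricted[OF F F] emeasure_density_const[OF F]
      by (simp add: m.emeasure_eq_measure flip: ennreal_mult)
    thus ?case using elim(2) by (simp add: \<Phi>_def)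
  qed
  hence cc: "c = c * c" by simp
  have "emeasure \<nu> A = (\<integral>\<^sup>+x. ennreal c \<partial>\<mu>)"
    unfolding emeasure_\<nu>[OF A] by (rule nn_integral_cong_AE) (use c in \<open>eventually_elim, simp add: \<Phi>_def\<close>)
  hence "measure \<nu> A = c" using c01 by (simp add: emeasure_space_1 measure_def)
  thus ?thesis using cc by auto
qed


lemma prob_space_\<nu>: "prob_space \<nu>"
  by (rule prod.prob_space_axioms)

lemma ergodic_\<nu>: "ergodic K \<nu>"
  unfolding ergodic_def
proof (intro conjI ballI impI prob_space_\<nu> invariant_\<nu>)
  fix A assume A: "A \<in> sets \<nu>" and inv: "K -` A \<inter> space \<nu> = A"
  have "AE z in \<nu>. K z \<in> A \<longleftrightarrow> z \<in> A"
    using AE_space by eventually_elim (use inv in blast)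
  thus "measure \<nu> A = 0 \<or> measure \<nu> A = 1" by (rule ergodic_AE_invariant[OF A])
qed

section \<open>Uniqueness\<close>

lemma sets_\<nu>: "sets \<nu> = sets (m \<Otimes>\<^sub>M lam)"
  by (intro sets_pair_measure_cong refl sets_\<mu>)

text \<open>A set is null for the product exactly when almost every fibre is null, and almost
  everywhere means the same for \<open>\<mu>\<close> and for \<open>lam\<close>.\<close>

lemma null_sets_\<nu>: "null_sets \<nu> = null_sets (m \<Otimes>\<^sub>M lam)"
proof (rule set_eqI)
  interpret lam: prob_space lam by (rule prob_space_lam)
  interpret l: pair_prob_space m lam ..
  fix A
  show "A \<in> null_sets \<nu> \<longleftrightarrow> A \<in> null_sets (m \<Otimes>\<^sub>M lam)"
  proof (cases "A \<in> sets \<nu>")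
    case True
    hence A: "A \<in> sets (m \<Otimes>\<^sub>M lam)" by (simp add: sets_\<nu>)
    have "emeasure \<nu> A = 0 \<longleftrightarrow> (AE x in \<mu>. emeasure m ((\<lambda>\<omega>. (\<omega>, x)) -` A) = 0)"
      unfolding prod.emeasure_pair_measure_alt2[OF True]
      by (rule nn_integral_0_iff_AE[OF prod.measurable_emeasure_Pair2[OF True]])
    also have "\<dots> \<longleftrightarrow> (AE x in lam. emeasure m ((\<lambda>\<omega>. (\<omega>, x)) -` A) = 0)"
      unfolding AE_\<mu>_iff AE_lam_iff ..
    also have "\<dots> \<longleftrightarrow> emeasure (m \<Otimes>\<^sub>M lam) A = 0"
      unfolding l.emeasure_pair_measure_alt2[OF A]
      by (rule nn_integral_0_iff_AE[OF l.measurable_emeasure_Pair2[OF A], symmetric])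
    finally show ?thesis using True A by (simp add: null_sets_def)
  qed (auto simp: sets_\<nu>)
qed

lemma acim_\<nu>: "acim \<beta> p \<nu>"
  using prob_space_\<nu> sets_\<nu> invariant_\<nu> by (auto simp: acim_def absolutely_continuous_def null_sets_\<nu>)

text \<open>For an absolutely continuous invariant \<open>N\<close> with density \<open>D\<close>, the set \<open>A = {D > 1}\<close> maximises
  \<open>N - \<nu>\<close>, and so does its preimage. Hence \<open>A\<close> is invariant modulo null sets.\<close>

lemma acim_unique:
  assumes "acim \<beta> p N"
  shows "N = \<nu>"
proof -
  have N: "prob_space N" "sets N = sets \<nu>" "absolutely_continuous \<nu> N" "invariant_measure K N"
    using assms by (auto simp: acim_def absolutely_continuous_def null_sets_\<nu> sets_\<nu>)
  interpret N: prob_space N by fact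
  obtain D where D: "D \<in> borel_measurable \<nu>" "AE z in \<nu>. RN_deriv \<nu> N z = ennreal (D z)" "\<And>z. 0 \<le> D z"
    using prod.real_RN_deriv[OF N.finite_measure_axioms N(3,2)] by metis
  have Dm [measurable]: "D \<in> borel_measurable \<nu>" by (rule D)
  have "density \<nu> (\<lambda>z. ennreal (D z)) = density \<nu> (RN_deriv \<nu> N)"
    using D(2) by (intro density_cong) auto
  hence NN: "N = density \<nu> (\<lambda>z. ennreal (D z))" using prod.density_RN_deriv[OF N(3,2)] by simp
  have iD: "integrable \<nu> D"
  proof (rule integrableI_nonneg)
    have "(\<integral>\<^sup>+z. ennreal (D z) \<partial>\<nu>) = emeasure N (space N)"
      unfolding NN by (subst emeasure_density) (auto intro!: nn_integral_cong)
    thus "(\<integral>\<^sup>+z. ennreal (D z) \<partial>\<nu>) < \<infinity>" by (simp add: N.emeasure_space_1)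
  qed (use D in auto)
  define k where "k z = D z - 1" for z
  have ik: "integrable \<nu> k" unfolding k_def using iD by simp
  have iBk: "integrable \<nu> (\<lambda>z. indicator B z * k z)" if "B \<in> sets \<nu>" for B
    using integrable_mult_indicator[OF that ik] by simp
  have diff: "(\<integral>z. indicator B z * k z \<partial>\<nu>) = measure N B - measure \<nu> B" if B: "B \<in> sets \<nu>" for B
  proof -
    have iB: "integrable \<nu> (\<lambda>z. indicator B z * D z)"
      using integrable_mult_indicator[OF B iD] by simp
    have "emeasure N B = (\<integral>\<^sup>+z. ennreal (indicator B z * D z) \<partial>\<nu>)"
      unfolding NN using B by (subst emeasure_density) (auto intro!: nn_integral_cong simp: indicator_def)
    also have "\<dots> = ennreal (\<integral>z. indicator B z * D z \<partial>\<nu>)"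
      using D(3) by (intro nn_integral_eq_integral iB) auto
    finally have "measure N B = (\<integral>z. indicator B z * D z \<partial>\<nu>)"
      using D(3) by (simp add: measure_def integral_nonneg_AE)
    moreover have "(\<integral>z. indicator B z * k z \<partial>\<nu>) = (\<integral>z. indicator B z * D z - indicator B z \<partial>\<nu>)"
      by (intro Bochner_Integration.integral_cong) (auto simp: k_def algebra_simps)
    moreover have "\<dots> = (\<integral>z. indicator B z * D z \<partial>\<nu>) - measure \<nu> B"
      using B by (subst Bochner_Integration.integral_diff[OF iB]) (auto simp: integrable_indicator_iff prod.emeasure_eq_measure)
    ultimately show ?thesis by simp
  qed
  have int0: "(\<integral>z. k z \<partial>\<nu>) = 0"
  proof -
    have "(\<integral>z. k z \<partial>\<nu>) = (\<integral>z. indicator (space \<nu>) z * k z \<partial>\<nu>)"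
      by (intro Bochner_Integration.integral_cong) auto
    thus ?thesis using diff[of "space \<nu>"] N.prob_space prod.prob_space sets_eq_imp_space_eq[OF N(2)] by simp
  qed
  define A where "A = {z \<in> space \<nu>. D z > 1}"
  define A' where "A' = K -` A \<inter> space \<nu>"
  have A [measurable]: "A \<in> sets \<nu>" unfolding A_def by measurable
  have A' [measurable]: "A' \<in> sets \<nu>" unfolding A'_def by measurable
  have pre: "measure M A' = measure M A" if "invariant_measure K M" "sets M = sets \<nu>" for M
  proof -
    have "measure M A = measure (distr M M K) A" using that by (simp add: invariant_measure_def)
    also have "\<dots> = measure M A'"
      unfolding A'_def sets_eq_imp_space_eq[OF that(2), symmetric]
      using that A by (intro measure_distr) (auto simp: invariant_measure_def)
    finally show ?thesis by simp
  qed
  \<comment> \<open>\<open>A\<close> is the set where \<open>k > 0\<close>, so replacing any other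
    set by \<open>A\<close> can only increase the integrand.\<close>
  have nn: "AE z in \<nu>. 0 \<le> indicator A z * k z - indicator A' z * k z"
    using AE_space by eventually_elim (auto simp: A_def A'_def k_def indicator_def)
  \<comment> \<open>\<open>N\<close> and \<open>\<nu>\<close> are both invariant, so each gives
    \<open>A\<close> and \<open>A'\<close> the same measure.\<close>
  have "(\<integral>z. indicator A z * k z - indicator A' z * k z \<partial>\<nu>) = 0"
    using diff[OF A] diff[OF A'] pre[OF N(4,2)] pre[OF invariant_\<nu> refl] iBk[OF A] iBk[OF A'] by simp
  hence zero: "AE z in \<nu>. indicator A z * k z - indicator A' z * k z = 0"
    using nn iBk[OF A] iBk[OF A'] by (subst (asm) integral_nonneg_eq_0_iff_AE) auto
  have sub: "AE z in \<nu>. z \<in> A \<longrightarrow> z \<in> A'"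
    using zero by eventually_elim (auto simp: A_def k_def indicator_def)
  \<comment> \<open>\<open>A\<close> is contained in \<open>A'\<close> up to a null set, and the two
    have equal measure.\<close>
  have "measure \<nu> (A' - A) = 0"
  proof -
    have "measure \<nu> A = measure \<nu> (A' \<inter> A)"
      using sub by (intro measure_eq_AE) auto
    moreover have "measure \<nu> A' = measure \<nu> (A' - A) + measure \<nu> (A' \<inter> A)"
      using prod.finite_measure_Union[of "A' - A" "A' \<inter> A"] by (auto simp: Un_Diff_Int)
    ultimately show ?thesis using pre[OF invariant_\<nu> refl] by simp
  qed
  hence "A' - A \<in> null_sets \<nu>" by (simp add: null_sets_def prod.emeasure_eq_measure)
  hence "AE z in \<nu>. z \<notin> A' - A" by (rule AE_not_in)
  hence "AE z in \<nu>. K z \<in> A \<longleftrightarrow> z \<in> A"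
    using sub AE_space by eventually_elim (auto simp: A'_def)
  \<comment> \<open>In either case \<open>k\<close> has constant sign almost everywhere, while its
    integral is \<open>0\<close>.\<close>
  from ergodic_AE_invariant[OF A this] have "AE z in \<nu>. k z = 0"
  proof
    assume "measure \<nu> A = 0"
    hence "A \<in> null_sets \<nu>" by (simp add: null_sets_def prod.emeasure_eq_measure)
    hence "AE z in \<nu>. z \<notin> A" by (rule AE_not_in)
    hence le: "AE z in \<nu>. 0 \<le> - k z"
      using AE_space by eventually_elim (auto simp: A_def k_def)
    have "(\<integral>z. - k z \<partial>\<nu>) = 0" using int0 by simp
    thus ?thesis using integral_nonneg_eq_0_iff_AE[OF _ le] ik by simp
  next
    assume "measure \<nu> A = 1"
    hence "AE z in \<nu>. z \<in> A" by (intro prod.AE_prob_1)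
    hence "AE z in \<nu>. 0 \<le> k z" by eventually_elim (auto simp: A_def k_def)
    thus ?thesis using int0 integral_nonneg_eq_0_iff_AE[OF ik] by blast
  qed
  hence "N = density \<nu> (\<lambda>z. 1)"
    unfolding NN by (intro density_cong) (auto simp: k_def elim!: eventually_mono)
  thus ?thesis by (simp add: density_1)
qed

lemma measure_\<mu>_stationary:
  assumes B: "B \<in> sets lam"
  shows "measure \<mu> B = p * measure \<mu> (T -` B \<inter> space \<mu>) + (1 - p) * measure \<mu> (L -` B \<inter> space \<mu>)"
proof -
  have B' [measurable]: "B \<in> sets \<mu>" using B by (simp add: sets_\<mu>)
  have "emeasure \<mu> B = (\<integral>\<^sup>+x. indicator B x \<partial>\<mu>)" by simp
  also have "\<dots> = (\<integral>\<^sup>+x. ennreal p * indicator B (T x) + ennreal (1 - p) * indicator B (L x) \<partial>\<mu>)"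
    using B by (intro stationary[symmetric]) simp
  also have "\<dots> = (\<integral>\<^sup>+x. ennreal p * indicator (T -` B \<inter> space \<mu>) x + ennreal (1 - p) * indicator (L -` B \<inter> space \<mu>) x \<partial>\<mu>)"
    by (intro nn_integral_cong) (simp add: indicator_def)
  also have "\<dots> = ennreal p * emeasure \<mu> (T -` B \<inter> space \<mu>) + ennreal (1 - p) * emeasure \<mu> (L -` B \<inter> space \<mu>)"
    by (simp add: nn_integral_add nn_integral_cmult)
  also have "\<dots> = ennreal (p * measure \<mu> (T -` B \<inter> space \<mu>) + (1 - p) * measure \<mu> (L -` B \<inter> space \<mu>))"
    using p by (simp add: emeasure_eq_measure ennreal_mult)
  finally show ?thesis using p unfolding emeasure_eq_measure by (subst (asm) ennreal_inj) auto
qed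

end

theorem mainTheorem1:
  fixes \<beta> p :: real
  assumes "\<beta> > 1" and "\<beta> \<notin> \<int>" and "p \<in> {0<..<1}"
  shows "(\<exists>!\<nu>. acim \<beta> p \<nu>) \<and>
    (\<forall>\<nu>. acim \<beta> p \<nu> \<longrightarrow>
      (\<exists>\<mu>. prob_space \<mu> \<and> sets \<mu> = sets (normalized_lebesgue \<beta>) \<and>
           \<nu> = bernoulli_measure p \<Otimes>\<^sub>M \<mu> \<and>
           absolutely_continuous (normalized_lebesgue \<beta>) \<mu> \<and> absolutely_continuous \<mu> (normalized_lebesgue \<beta>) \<and>
           ergodic (random_map \<beta>) (bernoulli_measure p \<Otimes>\<^sub>M \<mu>) \<and>
           (\<forall>B\<in>sets (normalized_lebesgue \<beta>). measure \<mu> B =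
              p * measure \<mu> (greedy_map \<beta> -` B \<inter> space \<mu>) +
              (1 - p) * measure \<mu> (lazy_map \<beta> -` B \<inter> space \<mu>))))"
proof -
  interpret random_beta_system \<beta> p using assms by unfold_locales auto
  obtain \<mu> where \<mu>: "prob_space \<mu>" "sets \<mu> = sets (normalized_lebesgue \<beta>)"
    "null_sets \<mu> = null_sets (normalized_lebesgue \<beta>)"
    and stat: "\<And>F. F \<in> borel_measurable (normalized_lebesgue \<beta>) \<Longrightarrow>
      (\<integral>\<^sup>+x. ennreal p * F (greedy_map \<beta> x) + ennreal (1 - p) * F (lazy_map \<beta> x) \<partial>\<mu>) = (\<integral>\<^sup>+x. F x \<partial>\<mu>)"
    by (rule stationary_measure_exists) blast
  interpret stationary_measure \<beta> p \<mu>
    by (intro stationary_measure.intro stationary_measure_axioms.intro random_beta_system_axioms \<mu> stat)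
  have "prob_space \<mu> \<and> sets \<mu> = sets (normalized_lebesgue \<beta>) \<and>
      absolutely_continuous (normalized_lebesgue \<beta>) \<mu> \<and> absolutely_continuous \<mu> (normalized_lebesgue \<beta>) \<and>
      ergodic (random_map \<beta>) (bernoulli_measure p \<Otimes>\<^sub>M \<mu>) \<and>
      (\<forall>B\<in>sets (normalized_lebesgue \<beta>). measure \<mu> B =
         p * measure \<mu> (greedy_map \<beta> -` B \<inter> space \<mu>) +
         (1 - p) * measure \<mu> (lazy_map \<beta> -` B \<inter> space \<mu>))"
    using \<mu> ergodic_\<nu> measure_\<mu>_stationary by (simp add: absolutely_continuous_def)
  \<comment> \<open>Every \<open>acim\<close> equals the product measure, so the properties shown
    for the product carry over to it.\<close>
  thus ?thesis using acim_\<nu> acim_unique by metis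
qed

end
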